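(* The differential operators $D_a(x\,|\,y)$ $(a=1,\dots,N)$, acting on $V^{\otimes n}$-valued functions, commute with each other: $[D_a(x\,|\,y),D_b(x\,|\,y)]=0$ for all $1\le a,b\le N$.
   Context: Let $n,N$ be positive integers and $c,k,\alpha,\beta$ generic non-zero complex numbers. $V=\bigoplus_{a=1}^N(\mathbb{C}v_a\oplus\mathbb{C}v_{\bar a})$ has basis $v_1,\dots,v_N,v_{\bar1},\dots,v_{\bar N}$; $x=(x_1,\dots,x_N)\in(\mathbb{C}^\times)^N$, $y=(y_1,\dots,y_n)\in\mathbb{C}^n$. $e_{ab}$ ($a,b\in\{1,\dots,N,\bar1,\dots,\bar N\}$) are the matrix units, $e_{ab}v_p=\delta_{bp}v_a$, and $u^{(j)}$ denotes $u\in\mathrm{End}(V)$ acting on the $j$-th factor of $V^{\otimes n}$. For $1\le a,b\le N$: $E_{ab}=e_{ab}+e_{\bar a\bar b}$, $\overline E_{ab}=e_{a\bar b}+e_{\bar ab}$, and $$\mathbf X_{ab}=\sum_{1\le i<j\le n}\bigl(e_{ab}^{(i)}E_{ba}^{(j)}+e_{\bar b\bar a}^{(i)}E_{ab}^{(j)}\bigr),\quad \mathbf Y_{ab}=\sum_{1\le i<j\le n}\bigl(e_{a\bar b}^{(i)}\overline E_{ba}^{(j)}+e_{b\bar a}^{(i)}\overline E_{ab}^{(j)}\bigr),\quad \mathbf Z_{ab}=\sum_{1\le i<j\le n}\bigl(e_{\bar ab}^{(i)}\overline E_{ba}^{(j)}+e_{\bar ba}^{(i)}\overline E_{ab}^{(j)}\bigr).$$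 $$A_a(y)=\sum_{j=1}^ny_j\bigl(e_{aa}^{(j)}-e_{\bar a\bar a}^{(j)}\bigr)+2\alpha\sum_{j=1}^ne_{a\bar a}^{(j)}+k\Bigl(-\sum_{p=1}^{a-1}\mathbf X_{pa}+\sum_{p=a+1}^N\mathbf X_{ap}+\sum_{p=1}^N\mathbf Y_{ap}\Bigr),$$ $$B_a(x)=2\,\frac{\alpha+\beta x_a}{x_a^2-1}\sum_{j=1}^n\overline E_{aa}^{(j)}+k\Bigl\{\sum_{p=1}^{a-1}\frac{x_a}{x_a-x_p}(\mathbf X_{ap}+\mathbf X_{pa})+\sum_{p=a+1}^N\frac{x_p}{x_a-x_p}(\mathbf X_{ap}+\mathbf X_{pa})+\sum_{p=1}^N\frac{1}{x_ax_p-1}(\mathbf Y_{ap}+\mathbf Z_{ap})\Bigr\},$$ $L_a(x\,|\,y)=A_a(y)+B_a(x)$ and $D_a(x\,|\,y)=c\,x_a\frac{\partial}{\partial x_a}+L_a(x\,|\,y)$. All coefficients are rational functions and identities are identities of rational functions. *)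

theory Defs
  imports "HOL-Analysis.Analysis"
begin

text \<open>
  The index set \<open>{1..N}\<close> is a finite linearly ordered type \<open>'N\<close>, and the tensor positions
  \<open>{1..n}\<close> are a finite linearly ordered type \<open>'n\<close>. The basis of \<open>V\<close> is indexed by \<open>'N + 'N\<close>,
  where \<open>Inl a\<close> stands for \<open>v\<^sub>a\<close> and \<open>Inr a\<close> for the barred vector.
  A vector of \<open>V\<^sup>\<otimes>\<^sup>n\<close> is given by its coordinates in the tensor product basis, which is indexed by
  the functions \<open>f :: 'n \<Rightarrow> 'N + 'N\<close>: the basis vector with index \<open>f\<close> is
  \<open>v\<^bsub>f 1\<^esub> \<otimes> \<dots> \<otimes> v\<^bsub>f n\<^esub>\<close>. Endomorphisms of \<open>V\<close> and of \<open>V\<^sup>\<otimes>\<^sup>n\<close> are matrices acting by \<open>*v\<close>.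
\<close>

type_synonym 'N V = "complex ^ ('N + 'N)"
type_synonym 'N EndV = "complex ^ ('N + 'N) ^ ('N + 'N)"
type_synonym ('n, 'N) VT = "complex ^ ('n \<Rightarrow> 'N + 'N)"
type_synonym ('n, 'N) EndVT = "complex ^ ('n \<Rightarrow> 'N + 'N) ^ ('n \<Rightarrow> 'N + 'N)"

definition mscale :: "complex \<Rightarrow> complex ^ 'm ^ 'l \<Rightarrow> complex ^ 'm ^ 'l"  (infixr \<open>*\<^sub>M\<close> 75)
  where "z *\<^sub>M A = (\<chi> i j. z * A $ i $ j)"

definition munit :: "'N + 'N \<Rightarrow> 'N + 'N \<Rightarrow> ('N::finite) EndV"
  where "munit a b = (\<chi> p q. if p = a \<and> q = b then 1 else 0)"

definition pure :: "('n \<Rightarrow> ('N::finite) V) \<Rightarrow> ('n::finite, 'N) VT"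
  where "pure t = (\<chi> f. \<Prod>j\<in>UNIV. t j $ f j)"

text \<open>\<open>site u j\<close> is \<open>u\<^sup>(\<^sup>j\<^sup>)\<close>; the lemma \<open>site_pure\<close> below characterises it on pure tensors.\<close>

definition site :: "('N::finite) EndV \<Rightarrow> 'n \<Rightarrow> ('n::finite, 'N) EndVT"
  where "site u j = (\<chi> f g. if \<forall>i. i \<noteq> j \<longrightarrow> f i = g i then u $ f j $ g j else 0)"

lemma munit_axis: "munit a b *v axis p 1 = (if p = b then axis a 1 else 0)"
proof -
  have "(munit a b *v axis p 1) $ i = munit a b $ i $ p" for i
  proof -
    have "(munit a b *v axis p 1) $ i = (\<Sum>q\<in>UNIV. if q = p then munit a b $ i $ q else 0)"
      unfolding matrix_vector_mult_def axis_def vec_lambda_beta by (rule sum.cong) auto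
    then show ?thesis by simp
  qed
  then show ?thesis by (auto simp: vec_eq_iff munit_def axis_def)
qed

lemma pure_axis: "pure (\<lambda>j. axis (f j) 1) = axis f 1"
proof -
  have "pure (\<lambda>j. axis (f j) 1) $ g = axis f 1 $ g" for g
  proof (cases "g = f")
    case True
    then show ?thesis by (simp add: pure_def axis_def)
  next
    case False
    then obtain j where "g j \<noteq> f j" by (auto simp: fun_eq_iff)
    then have "(\<Prod>j\<in>UNIV. axis (f j) (1::complex) $ g j) = 0"
      by (intro prod_zero) (auto simp: axis_def)
    with False show ?thesis by (simp add: pure_def axis_def)
  qed
  then show ?thesis by (simp add: vec_eq_iff)
qed

lemma site_pure: "site u j *v pure t = pure (t(j := u *v t j))"
proof -
  have "(site u j *v pure t) $ f = pure (t(j := u *v t j)) $ f" for f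
  proof -
    let ?r = "\<Prod>i\<in>UNIV - {j}. t i $ f i"
    let ?S = "{g. \<forall>i. i \<noteq> j \<longrightarrow> f i = g i}"
    have S: "?S = (\<lambda>q. f(j := q)) ` UNIV"
      by (auto simp: image_iff fun_eq_iff)
    have inj: "inj (\<lambda>q. f(j := q))"
      by (metis fun_upd_same injI)
    have "(site u j *v pure t) $ f =
        (\<Sum>g\<in>UNIV. if g \<in> ?S then u $ f j $ g j * (\<Prod>i\<in>UNIV. t i $ g i) else 0)"
      unfolding site_def pure_def matrix_vector_mult_def
      by (auto intro!: sum.cong)
    also have "\<dots> = (\<Sum>g\<in>?S. u $ f j $ g j * (\<Prod>i\<in>UNIV. t i $ g i))"
      by (subst sum.inter_restrict[symmetric]) auto
    also have "\<dots> = (\<Sum>q\<in>UNIV. u $ f j $ q * (\<Prod>i\<in>UNIV. t i $ (f(j := q)) i))"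
      unfolding S by (subst sum.reindex[OF inj]) simp
    also have "\<dots> = (\<Sum>q\<in>UNIV. u $ f j $ q * t j $ q * ?r)"
    proof (rule sum.cong[OF refl])
      fix q
      have "(\<Prod>i\<in>UNIV. t i $ (f(j := q)) i) = t j $ q * (\<Prod>i\<in>UNIV - {j}. t i $ (f(j := q)) i)"
        by (subst prod.remove[of _ j]) auto
      also have "(\<Prod>i\<in>UNIV - {j}. t i $ (f(j := q)) i) = ?r"
        by (rule prod.cong) auto
      finally show "u $ f j $ q * (\<Prod>i\<in>UNIV. t i $ (f(j := q)) i) = u $ f j $ q * t j $ q * ?r"
        by simp
    qed
    also have "\<dots> = (u *v t j) $ f j * ?r"
      by (simp add: matrix_vector_mult_def sum_distrib_right)
    also have "\<dots> = pure (t(j := u *v t j)) $ f"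
    proof -
      have "(\<Prod>i\<in>UNIV. (t(j := u *v t j)) i $ f i)
          = (u *v t j) $ f j * (\<Prod>i\<in>UNIV - {j}. (t(j := u *v t j)) i $ f i)"
        by (subst prod.remove[of _ j]) auto
      also have "(\<Prod>i\<in>UNIV - {j}. (t(j := u *v t j)) i $ f i) = ?r"
        by (rule prod.cong) auto
      finally show ?thesis by (simp add: pure_def)
    qed
    finally show ?thesis .
  qed
  then show ?thesis by (simp add: vec_eq_iff)
qed

definition EE :: "'N \<Rightarrow> 'N \<Rightarrow> ('N::finite) EndV"
  where "EE a b = munit (Inl a) (Inl b) + munit (Inr a) (Inr b)"

definition EEbar :: "'N \<Rightarrow> 'N \<Rightarrow> ('N::finite) EndV"
  where "EEbar a b = munit (Inl a) (Inr b) + munit (Inr a) (Inl b)"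

definition XX :: "'N \<Rightarrow> 'N \<Rightarrow> ('n::{finite,linorder}, 'N::finite) EndVT"
  where "XX a b = (\<Sum>(i, j)\<in>{(i, j). i < j}.
     site (munit (Inl a) (Inl b)) i ** site (EE b a) j
   + site (munit (Inr b) (Inr a)) i ** site (EE a b) j)"

definition YY :: "'N \<Rightarrow> 'N \<Rightarrow> ('n::{finite,linorder}, 'N::finite) EndVT"
  where "YY a b = (\<Sum>(i, j)\<in>{(i, j). i < j}.
     site (munit (Inl a) (Inr b)) i ** site (EEbar b a) j
   + site (munit (Inl b) (Inr a)) i ** site (EEbar a b) j)"

definition ZZ :: "'N \<Rightarrow> 'N \<Rightarrow> ('n::{finite,linorder}, 'N::finite) EndVT"
  where "ZZ a b = (\<Sum>(i, j)\<in>{(i, j). i < j}.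
     site (munit (Inr a) (Inl b)) i ** site (EEbar b a) j
   + site (munit (Inr b) (Inl a)) i ** site (EEbar a b) j)"

definition AA :: "complex \<Rightarrow> complex \<Rightarrow> complex ^ 'n::{finite,linorder} \<Rightarrow> 'N \<Rightarrow>
    ('n, 'N::{finite,linorder}) EndVT"
  where "AA k \<alpha> y a =
     (\<Sum>j\<in>UNIV. y $ j *\<^sub>M (site (munit (Inl a) (Inl a)) j - site (munit (Inr a) (Inr a)) j))
   + (2 * \<alpha>) *\<^sub>M (\<Sum>j\<in>UNIV. site (munit (Inl a) (Inr a)) j)
   + k *\<^sub>M (- (\<Sum>p\<in>{..<a}. XX p a) + (\<Sum>p\<in>{a<..}. XX a p) + (\<Sum>p\<in>UNIV. YY a p))"

definition BB :: "complex \<Rightarrow> complex \<Rightarrow> complex \<Rightarrow> complex ^ 'N::{finite,linorder} \<Rightarrow> 'N \<Rightarrow>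
    ('n::{finite,linorder}, 'N) EndVT"
  where "BB k \<alpha> \<beta> x a =
     (2 * ((\<alpha> + \<beta> * x $ a) / ((x $ a)\<^sup>2 - 1))) *\<^sub>M (\<Sum>j\<in>UNIV. site (EEbar a a) j)
   + k *\<^sub>M ((\<Sum>p\<in>{..<a}. (x $ a / (x $ a - x $ p)) *\<^sub>M (XX a p + XX p a))
         + (\<Sum>p\<in>{a<..}. (x $ p / (x $ a - x $ p)) *\<^sub>M (XX a p + XX p a))
         + (\<Sum>p\<in>UNIV. (1 / (x $ a * x $ p - 1)) *\<^sub>M (YY a p + ZZ a p)))"

definition LL :: "complex \<Rightarrow> complex \<Rightarrow> complex \<Rightarrow> complex ^ 'n::{finite,linorder} \<Rightarrow>
    complex ^ 'N::{finite,linorder} \<Rightarrow> 'N \<Rightarrow> ('n, 'N) EndVT"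
  where "LL k \<alpha> \<beta> y x a = AA k \<alpha> y a + BB k \<alpha> \<beta> x a"

definition partial_deriv :: "'N \<Rightarrow> (complex ^ 'N \<Rightarrow> complex ^ 'm) \<Rightarrow> complex ^ 'N \<Rightarrow> complex ^ 'm"
  where "partial_deriv a F x = (\<chi> f. deriv (\<lambda>z. F (\<chi> p. if p = a then z else x $ p) $ f) (x $ a))"

definition DD :: "complex \<Rightarrow> complex \<Rightarrow> complex \<Rightarrow> complex \<Rightarrow> complex ^ 'n::{finite,linorder} \<Rightarrow> 'N \<Rightarrow>
    (complex ^ 'N::{finite,linorder} \<Rightarrow> ('n, 'N) VT) \<Rightarrow>
    (complex ^ 'N::{finite,linorder} \<Rightarrow> ('n, 'N) VT)"
  where "DD c k \<alpha> \<beta> y a F = (\<lambda>x. (c * x $ a) *s partial_deriv a F x + LL k \<alpha> \<beta> y x a *v F x)"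

definition commutator :: "(('a \<Rightarrow> 'b) \<Rightarrow> ('a \<Rightarrow> 'b)) \<Rightarrow> (('a \<Rightarrow> 'b) \<Rightarrow> ('a \<Rightarrow> 'b)) \<Rightarrow>
    ('a \<Rightarrow> 'b) \<Rightarrow> ('a \<Rightarrow> 'b::ab_group_add)"
  where "commutator P Q F = (\<lambda>x. P (Q F) x - Q (P F) x)"

text \<open>
  The points of the torus at which none of the rational coefficients has a pole
  (\<open>p = a\<close> in the last condition gives \<open>(x $ a)\<^sup>2 \<noteq> 1\<close>). A function on an open subset \<open>U\<close> of it is
  represented by a total function, of which only the values on \<open>U\<close> matter.
\<close>

definition regular_locus :: "(complex ^ 'N) set"
  where "regular_locus = {x. (\<forall>a. x $ a \<noteq> 0) \<and> (\<forall>a p. a \<noteq> p \<longrightarrow> x $ a \<noteq> x $ p)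
                           \<and> (\<forall>a p. x $ a * x $ p \<noteq> 1)}"

text \<open>Holomorphy in several variables: a complex linear Frechet derivative at every point.\<close>

definition holomorphic_vec :: "(complex ^ 'N \<Rightarrow> complex ^ 'm) \<Rightarrow> (complex ^ 'N) set \<Rightarrow> bool"
  where "holomorphic_vec F U \<longleftrightarrow>
     (\<forall>x\<in>U. \<exists>F'. (F has_derivative F') (at x) \<and> (\<forall>z v. F' (z *s v) = z *s F' v))"

end

(* Idea: extend the index set to I = {1..N} together with the barred indices and put
   x_(bar p) = 1 / x_p. With E_ab = e_ab + e_(bar a)(bar b) for all a, b in I, a single family
   X_ab (a, b in I) comprises XX, YY and ZZ, and satisfies X_(bar b)(bar a) = X_ab. Clearing the
   order-dependent coefficients, L_a becomes
     H_a + W_a + k (sum of R_aq over q in I other than a, bar a),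
     R_pq = (x_p X_pq + x_q X_qp) / (x_p - x_q),
   with H_a the y-part and W_a the part living on the pair {a, bar a}. The R_pq solve the classical
   Yang-Baxter equation on triples of indices from three different classes {p, bar p}, and the
   remaining terms of [L_a, L_b] cancel by a reflection equation relating W_a, W_b, R_ab and
   R_a(bar b). Both reduce to identities on two or three tensor sites.
   The derivative terms cancel because x_a d/dx_a L_b is symmetric in a and b. *)
theory Submission
  imports Defs "HOL-Complex_Analysis.Cauchy_Integral_Formula"
begin

text \<open>Write P = R_ab and Q = R_a(bar b). Since R_ba = -P and R_b(bar a) = Q, the parts of L_a
  and L_b that couple a with b are k (P + Q) and k (-P + Q). Their bracket 2 k^2 [P, Q] is what W_a
  and W_b must compensate; this dictates the signs and the right side of the reflection equation.
  The y-part is separate: H_a + H_b commutes with P, and H_a - H_b commutes with Q. The equations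
  for R depend on x, while the X_pq are constant matrices. So the two aspects are split: a few
  parameter-free bracket relations, taken at several permutations and bars of the indices, are fed
  entry by entry into scalar identities between rational functions. On the analytic side, holomorphy
  only asserts a complex linear derivative at each point, without continuity. That the first partial
  derivatives can be differentiated again, and that the order does not matter, therefore needs an
  argument of its own.\<close>

section \<open>Mixed partial derivatives of holomorphic maps\<close>

text \<open>The difference quotients of \<open>g z\<close> at \<open>w0\<close> are holomorphic in \<open>z\<close> and, by Taylor's formula and
  Cauchy's estimate for the second derivative, converge uniformly in \<open>z\<close>; hence so do their \<open>z\<close>-derivatives.\<close>

lemma mixed_complex_derivatives:
  fixes g :: "complex \<Rightarrow> complex \<Rightarrow> complex"
  assumes R: "0 < R"
    and cont: "continuous_on (cball z0 R \<times> cball w0 R) (\<lambda>(z, w). g z w)"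
    and dz: "\<And>z w. z \<in> cball z0 R \<Longrightarrow> w \<in> cball w0 R \<Longrightarrow> (\<lambda>z. g z w) field_differentiable at z"
    and dw: "\<And>z w. z \<in> cball z0 R \<Longrightarrow> w \<in> cball w0 R \<Longrightarrow> g z field_differentiable at w"
  obtains D where "((\<lambda>z. deriv (g z) w0) has_field_derivative D) (at z0)"
    "((\<lambda>w. deriv (\<lambda>z. g z w) z0) has_field_derivative D) (at w0)"
proof -
  have "compact ((\<lambda>(z, w). g z w) ` (cball z0 R \<times> cball w0 R))"
    by (intro compact_continuous_image cont compact_Times compact_cball)
  then obtain M where M: "\<And>z w. z \<in> cball z0 R \<Longrightarrow> w \<in> cball w0 R \<Longrightarrow> norm (g z w) \<le> M"
    by (force dest!: compact_imp_bounded simp: bounded_iff)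
  \<comment> \<open>For \<open>w\<close> in \<open>ball w0 (R / 2)\<close> the disc of radius
    \<open>R / 2\<close> about \<open>w\<close> lies in \<open>cball w0 R\<close>, so Cauchy's
    inequality bounds the second derivative of \<open>g z\<close> there by \<open>B\<close>, for all
    \<open>z\<close> at once.\<close>
  define B where "B = 2 * M / (R / 2)\<^sup>2"
  have "0 \<le> M" using M[of z0 w0] R norm_ge_zero[of "g z0 w0"] by (meson centre_in_cball less_imp_le order_trans)
  then have B0: "0 \<le> B" by (simp add: B_def)
  have est: "norm (g z (w0 + h) - g z w0 - deriv (g z) w0 * h) \<le> B * (norm h)\<^sup>2"
    if z: "z \<in> cball z0 R" and h: "norm h < R / 2" for z h
  proof -
    have hol: "g z holomorphic_on cball w0 R"
      using dw[OF z] by (auto simp: holomorphic_on_def intro: field_differentiable_at_within)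
    have "norm ((deriv ^^ 0) (g z) (w0 + h) - (\<Sum>i\<le>1. (deriv ^^ i) (g z) w0 * (w0 + h - w0) ^ i / fact i))
        \<le> B * norm (w0 + h - w0) ^ Suc 1 / fact 1"
    proof (rule field_Taylor[where S = "ball w0 (R / 2)"])
      fix i :: nat and w assume w: "w \<in> ball w0 (R / 2)"
      then have "w \<in> ball w0 R" using R by auto
      then have "((deriv ^^ i) (g z) has_field_derivative (deriv ^^ Suc i) (g z) w) (at w)"
        by (intro has_field_derivative_higher_deriv[of _ "ball w0 R"] holomorphic_on_subset[OF hol]) auto
      then show "((deriv ^^ i) (g z) has_field_derivative (deriv ^^ Suc i) (g z) w) (at w within ball w0 (R / 2))"
        by (rule has_field_derivative_at_within)
    next
      fix w assume w: "w \<in> ball w0 (R / 2)"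
      have sub: "cball w (R / 2) \<subseteq> cball w0 R"
        using w by (auto simp: cball_subset_cball_iff dist_commute)
      have "norm ((deriv ^^ 2) (g z) w) \<le> fact 2 * M / (R / 2) ^ 2"
      proof (rule Cauchy_inequality)
        show "g z holomorphic_on ball w (R / 2)"
          using sub ball_subset_cball by (blast intro: holomorphic_on_subset[OF hol])
        show "continuous_on (cball w (R / 2)) (g z)"
          using sub by (blast intro: holomorphic_on_imp_continuous_on holomorphic_on_subset[OF hol])
        fix x assume "norm (w - x) = R / 2"
        then have "x \<in> cball w (R / 2)" by (simp add: dist_norm)
        then show "norm (g z x) \<le> M" using sub M[OF z] by blast
      qed (use R in simp)
      then show "norm ((deriv ^^ Suc 1) (g z) w) \<le> B"
        by (simp add: B_def numeral_2_eq_2)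
    qed (use R h in \<open>auto simp: dist_norm\<close>)
    then show ?thesis by (simp add: power2_eq_square algebra_simps)
  qed
  have lim: "uniform_limit (cball z0 R) (\<lambda>h z. (g z (w0 + h) - g z w0) / h) (\<lambda>z. deriv (g z) w0) (at 0)"
  proof (rule uniform_limitI)
    fix e :: real assume e: "0 < e"
    \<comment> \<open>The denominator is \<open>B + 1\<close> because \<open>B\<close> may be
      0.\<close>
    let ?d = "min (R / 2) (e / (B + 1))"
    have "0 < ?d" using R e B0 by auto
    moreover have "\<forall>z\<in>cball z0 R. dist ((g z (w0 + h) - g z w0) / h) (deriv (g z) w0) < e"
      if "h \<noteq> 0" "dist h 0 < ?d" for h
    proof
      fix z assume z: "z \<in> cball z0 R"
      have "dist ((g z (w0 + h) - g z w0) / h) (deriv (g z) w0)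
          = norm (g z (w0 + h) - g z w0 - deriv (g z) w0 * h) / norm h"
        using that by (simp add: dist_norm field_simps flip: norm_divide)
      also have "\<dots> \<le> B * norm h"
        using est[OF z, of h] that by (simp add: field_simps power2_eq_square)
      also have "\<dots> \<le> (B + 1) * norm h"
        by (simp add: algebra_simps)
      also have "\<dots> < e"
        using that B0 by (simp add: field_simps)
      finally show "dist ((g z (w0 + h) - g z w0) / h) (deriv (g z) w0) < e" .
    qed
    ultimately show "\<forall>\<^sub>F h in at 0. \<forall>z\<in>cball z0 R. dist ((g z (w0 + h) - g z w0) / h) (deriv (g z) w0) < e"
      unfolding eventually_at by blast
  qed
  have ev: "\<forall>\<^sub>F h in at 0. continuous_on (cball z0 R) (\<lambda>z. (g z (w0 + h) - g z w0) / h) \<and>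
      (\<forall>z\<in>ball z0 R. ((\<lambda>z. (g z (w0 + h) - g z w0) / h) has_field_derivative
        (deriv (\<lambda>z. g z (w0 + h)) z - deriv (\<lambda>z. g z w0) z) / h) (at z))"
    unfolding eventually_at
  proof (intro exI[of _ R] conjI ballI impI R)
    fix h :: complex assume h: "h \<noteq> 0 \<and> dist h 0 < R"
    then have mem: "w0 + h \<in> cball w0 R" "w0 \<in> cball w0 R"
      using R by (auto simp: dist_norm)
    have fd: "(\<lambda>z. (g z (w0 + h) - g z w0) / h) field_differentiable at z" if "z \<in> cball z0 R" for z
      using dz[OF that mem(1)] dz[OF that mem(2)] h by (intro field_differentiable_divide field_differentiable_diff) auto
    show "continuous_on (cball z0 R) (\<lambda>z. (g z (w0 + h) - g z w0) / h)"
      by (intro continuous_at_imp_continuous_on ballI field_differentiable_imp_continuous_at fd)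
    fix z assume "z \<in> ball z0 R"
    then have z: "z \<in> cball z0 R" by auto
    show "((\<lambda>z. (g z (w0 + h) - g z w0) / h) has_field_derivative
        (deriv (\<lambda>z. g z (w0 + h)) z - deriv (\<lambda>z. g z w0) z) / h) (at z)"
      using dz[OF z mem(1)] dz[OF z mem(2)]
      by (intro DERIV_cdivide DERIV_diff) (simp_all add: field_differentiable_derivI)
  qed
  obtain D where D: "\<And>z. z \<in> ball z0 R \<Longrightarrow> ((\<lambda>z. deriv (g z) w0) has_field_derivative D z) (at z) \<and>
      ((\<lambda>h. (deriv (\<lambda>z. g z (w0 + h)) z - deriv (\<lambda>z. g z w0) z) / h) \<longlongrightarrow> D z) (at 0)"
    by (rule has_complex_derivative_uniform_limit[OF ev lim at_neq_bot R]) (rule that)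
  \<comment> \<open>At \<open>z0\<close> the limit in \<open>h\<close> is the difference quotient in
    \<open>w\<close> of the \<open>z\<close>-derivative, so one \<open>D\<close> serves both
    claims.\<close>
  show thesis
    using D[of z0] R by (intro that[of "D z0"]) (auto simp: DERIV_def)
qed

section \<open>Partial derivatives of vector-valued holomorphic maps\<close>

definition upd :: "complex ^ 'N \<Rightarrow> 'N \<Rightarrow> complex \<Rightarrow> complex ^ 'N"
  where "upd x a z = (\<chi> p. if p = a then z else x $ p)"

lemma upd_nth [simp]: "upd x a z $ p = (if p = a then z else x $ p)"
  by (simp add: upd_def)

lemma upd_triv [simp]: "upd x a (x $ a) = x"
  by (simp add: upd_def vec_eq_iff)

lemma upd_commute: "a \<noteq> b \<Longrightarrow> upd (upd x a z) b w = upd (upd x b w) a z"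
  by (auto simp: upd_def vec_eq_iff)

lemma partial_deriv_nth: "partial_deriv a F x $ f = deriv (\<lambda>z. F (upd x a z) $ f) (x $ a)"
  by (simp add: partial_deriv_def upd_def)

lemma continuous_on_upd2: "continuous_on S (\<lambda>(z, w). upd (upd (x :: complex ^ 'N::finite) a z) b w)"
  unfolding upd_def case_prod_unfold
proof (rule continuous_on_vec_lambda)
  fix p
  show "continuous_on S (\<lambda>q. if p = b then snd q else (\<chi> p. if p = a then fst q else x $ p) $ p)"
    by (cases "p = b"; cases "p = a") (auto intro!: continuous_intros)
qed

lemma holomorphic_vec_partial:
  fixes F :: "complex ^ 'N::finite \<Rightarrow> complex ^ 'm::finite"
  assumes "holomorphic_vec F U" "upd x a z \<in> U"
  shows "(\<lambda>z. F (upd x a z) $ f) field_differentiable at z"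
proof -
  obtain F' where F': "(F has_derivative F') (at (upd x a z))" and lin: "\<And>z v. F' (z *s v) = z *s F' v"
    using assms by (auto simp: holomorphic_vec_def)
  have "linear (\<lambda>h. h *s axis a (1::complex) :: complex ^ 'N)"
    by (rule linearI) (auto simp: vec_eq_iff algebra_simps)
  then have "((\<lambda>h. h *s axis a (1::complex) :: complex ^ 'N) has_derivative (\<lambda>h. h *s axis a 1)) (at z)"
    by (intro bounded_linear_imp_has_derivative linear_conv_bounded_linear[THEN iffD1])
  then have "((\<lambda>z. upd x a 0 + z *s axis a 1) has_derivative (\<lambda>h. h *s axis a 1)) (at z)"
    using has_derivative_add[OF has_derivative_const] by fastforce
  moreover have "(\<lambda>z. upd x a 0 + z *s axis a 1) = upd x a"
    by (auto simp: vec_eq_iff axis_def)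
  ultimately have "(upd x a has_derivative (\<lambda>h. h *s axis a 1)) (at z)"
    by simp
  from has_derivative_compose[OF this F']
  have "((\<lambda>z. F (upd x a z) $ f) has_derivative (\<lambda>h. F' (h *s axis a 1) $ f)) (at z)"
    by (rule bounded_linear.has_derivative[OF bounded_linear_vec_nth])
  \<comment> \<open>Complex linearity of \<open>F'\<close> turns the real Frechet derivative along
    the coordinate line into a complex derivative.\<close>
  moreover have "F' (h *s axis a 1) $ f = F' (axis a 1) $ f * h" for h
    by (simp add: lin)
  ultimately have "((\<lambda>z. F (upd x a z) $ f) has_field_derivative F' (axis a 1) $ f) (at z)"
    by (simp add: has_field_derivative_def)
  then show ?thesis unfolding field_differentiable_def by blast
qed

text \<open>Restricting \<open>F\<close> to the slice in the coordinates \<open>a\<close>,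
  \<open>b\<close> and to a small closed polydisc inside \<open>U\<close> gives the setting of
  \<open>mixed_complex_derivatives\<close>. The first claim is needed besides the second:
  \<open>deriv\<close> is total, so an equation between its values does not show that
  \<open>partial_deriv b F\<close> is differentiable.\<close>

lemma mixed_partial_deriv:
  fixes F :: "complex ^ 'N::finite \<Rightarrow> complex ^ 'm::finite"
  assumes U: "open U" "x \<in> U" and F: "holomorphic_vec F U" and "a \<noteq> b"
  shows "((\<lambda>z. partial_deriv b F (upd x a z) $ f) has_field_derivative partial_deriv a (partial_deriv b F) x $ f) (at (x $ a))"
    and "partial_deriv a (partial_deriv b F) x $ f = partial_deriv b (partial_deriv a F) x $ f"
proof -
  let ?h = "\<lambda>(z, w). upd (upd x a z) b w"
  let ?g = "\<lambda>z w. F (upd (upd x a z) b w) $ f"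
  have "open (?h -` U)"
    using U by (intro open_vimage continuous_on_upd2)
  moreover have "(x $ a, x $ b) \<in> ?h -` U"
    using U by (simp add: upd_commute[OF \<open>a \<noteq> b\<close>])
  ultimately obtain A B where AB: "open A" "open B" "x $ a \<in> A" "x $ b \<in> B" "A \<times> B \<subseteq> ?h -` U"
    by (rule open_prod_elim) auto
  obtain r1 r2 where r: "r1 > 0" "cball (x $ a) r1 \<subseteq> A" "r2 > 0" "cball (x $ b) r2 \<subseteq> B"
    using AB by (meson open_contains_cball)
  define R where "R = min r1 r2"
  have R: "R > 0" and sub: "\<And>z w. z \<in> cball (x $ a) R \<Longrightarrow> w \<in> cball (x $ b) R \<Longrightarrow> upd (upd x a z) b w \<in> U"
  proof -
    show "R > 0" using r by (simp add: R_def)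
    fix z w assume "z \<in> cball (x $ a) R" "w \<in> cball (x $ b) R"
    then have "z \<in> cball (x $ a) r1" "w \<in> cball (x $ b) r2" by (auto simp: R_def)
    then have "(z, w) \<in> A \<times> B" using r by blast
    then have "(z, w) \<in> ?h -` U" using AB(5) by (rule rev_subsetD)
    then show "upd (upd x a z) b w \<in> U" by simp
  qed
  have contF: "continuous_on U (\<lambda>y. F y $ f)"
  proof (intro continuous_at_imp_continuous_on ballI)
    fix y assume "y \<in> U"
    then obtain F' where "(F has_derivative F') (at y)" using F unfolding holomorphic_vec_def by blast
    then have "isCont F y" by (rule has_derivative_continuous)
    then show "isCont (\<lambda>y. F y $ f) y" by (rule continuous_intros)
  qed
  obtain D where D: "((\<lambda>z. deriv (?g z) (x $ b)) has_field_derivative D) (at (x $ a))"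
    "((\<lambda>w. deriv (\<lambda>z. ?g z w) (x $ a)) has_field_derivative D) (at (x $ b))"
  proof (rule mixed_complex_derivatives[of R "x $ a" "x $ b" ?g])
    show "continuous_on (cball (x $ a) R \<times> cball (x $ b) R) (\<lambda>(z, w). ?g z w)"
      unfolding case_prod_unfold
      using sub by (intro continuous_on_compose2[OF contF] continuous_on_upd2[unfolded case_prod_unfold]) force
    fix z w assume zw: "z \<in> cball (x $ a) R" "w \<in> cball (x $ b) R"
    show "?g z field_differentiable at w"
      by (rule holomorphic_vec_partial[OF F sub[OF zw]])
    show "(\<lambda>z. ?g z w) field_differentiable at z"
      using holomorphic_vec_partial[OF F, of "upd x b w" a z f] sub[OF zw]
      by (simp add: upd_commute[OF \<open>a \<noteq> b\<close>])
  qed (rule R)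
  have 1: "(\<lambda>z. partial_deriv b F (upd x a z) $ f) = (\<lambda>z. deriv (?g z) (x $ b))"
    using \<open>a \<noteq> b\<close> by (simp add: partial_deriv_nth)
  have 2: "(\<lambda>w. partial_deriv a F (upd x b w) $ f) = (\<lambda>w. deriv (\<lambda>z. ?g z w) (x $ a))"
    using \<open>a \<noteq> b\<close> by (simp add: partial_deriv_nth upd_commute[OF \<open>a \<noteq> b\<close>])
  have eq: "partial_deriv a (partial_deriv b F) x $ f = D" "partial_deriv b (partial_deriv a F) x $ f = D"
    using D by (simp_all add: partial_deriv_nth[of _ "partial_deriv _ _"] 1 2 DERIV_imp_deriv)
  show "partial_deriv a (partial_deriv b F) x $ f = partial_deriv b (partial_deriv a F) x $ f"
    by (simp add: eq)
  show "((\<lambda>z. partial_deriv b F (upd x a z) $ f) has_field_derivative partial_deriv a (partial_deriv b F) x $ f) (at (x $ a))"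
    using D(1) by (simp add: eq 1)
qed

text \<open>The terms with derivatives of \<open>F\<close> cancel in pairs, leaving c (x_a d_a L_b -
  x_b d_b L_a) + [L_a, L_b] applied to \<open>F\<close>; \<open>sym\<close> and \<open>comm\<close>
  remove one summand each. \<open>Lb\<close> stands for the x_a-derivative of L_b and
  \<open>La\<close> for the x_b-derivative of L_a.\<close>

lemma connection_commute:
  fixes L :: "complex ^ 'N::finite \<Rightarrow> 'N \<Rightarrow> complex ^ 'm::finite ^ 'm"
    and F :: "complex ^ 'N \<Rightarrow> complex ^ 'm" and c :: complex and La Lb :: "complex ^ 'm ^ 'm"
  defines "D \<equiv> \<lambda>a F x. (c * x $ a) *s partial_deriv a F x + L x a *v F x"
  assumes U: "open U" "x \<in> U" and F: "holomorphic_vec F U" and "a \<noteq> b"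
    and Lb: "\<And>f g. ((\<lambda>z. L (upd x a z) b $ f $ g) has_field_derivative Lb $ f $ g) (at (x $ a))"
    and La: "\<And>f g. ((\<lambda>z. L (upd x b z) a $ f $ g) has_field_derivative La $ f $ g) (at (x $ b))"
    and sym: "\<And>f g. x $ a * Lb $ f $ g = x $ b * La $ f $ g"
    and comm: "L x a ** L x b = L x b ** L x a"
  shows "D a (D b F) x = D b (D a F) x"
proof -
  have DF: "((\<lambda>z. F (upd x e z) $ f) has_field_derivative partial_deriv e F x $ f) (at (x $ e))" for e f
    unfolding partial_deriv_nth
    by (intro field_differentiable_derivI holomorphic_vec_partial[OF F]) (simp add: U)
  have DD: "partial_deriv d (D e F) x $ f = c * x $ e * partial_deriv d (partial_deriv e F) x $ f
      + (\<Sum>g\<in>UNIV. L' $ f $ g * F x $ g) + (\<Sum>g\<in>UNIV. L x e $ f $ g * partial_deriv d F x $ g)"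
    if "d \<noteq> e" and L': "\<And>f g. ((\<lambda>z. L (upd x d z) e $ f $ g) has_field_derivative L' $ f $ g) (at (x $ d))"
    for d e L' f
  proof -
    have "((\<lambda>z. D e F (upd x d z) $ f) has_field_derivative
       c * x $ e * partial_deriv d (partial_deriv e F) x $ f
       + (\<Sum>g\<in>UNIV. L' $ f $ g * F x $ g + partial_deriv d F x $ g * L x e $ f $ g)) (at (x $ d))"
      unfolding D_def matrix_vector_mult_def using that(1)
      by (auto intro!: DERIV_add DERIV_sum DERIV_cmult mixed_partial_deriv(1)[OF U F]
          DERIV_mult[OF L' DF, unfolded upd_triv])
    then show ?thesis
      by (simp add: partial_deriv_nth[of d "D e F"] DERIV_imp_deriv sum.distrib mult.commute add.assoc)
  qed
  have "D a (D b F) x $ f = D b (D a F) x $ f" for f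
  proof -
    have expand: "D d (D e F) x $ f = c * c * x $ d * x $ e * partial_deriv d (partial_deriv e F) x $ f
        + c * (x $ d * (\<Sum>g\<in>UNIV. L' $ f $ g * F x $ g)) + c * x $ d * (L x e *v partial_deriv d F x) $ f
        + c * x $ e * (L x d *v partial_deriv e F x) $ f + ((L x d ** L x e) *v F x) $ f"
      if "d \<noteq> e" and L': "\<And>f g. ((\<lambda>z. L (upd x d z) e $ f $ g) has_field_derivative L' $ f $ g) (at (x $ d))"
      for d e L'
    proof -
      have "D d (D e F) x $ f = c * x $ d * partial_deriv d (D e F) x $ f + (L x d *v D e F x) $ f"
        by (simp add: D_def)
      also have "L x d *v D e F x = (c * x $ e) *s (L x d *v partial_deriv e F x) + (L x d ** L x e) *v F x"
        by (simp add: D_def matrix_vector_right_distrib matrix_vector_mul_assoc vector_scalar_commute)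
      finally show ?thesis
        unfolding DD[OF that] by (simp add: matrix_vector_mult_def algebra_simps)
    qed
    have "x $ a * (\<Sum>g\<in>UNIV. Lb $ f $ g * F x $ g) = x $ b * (\<Sum>g\<in>UNIV. La $ f $ g * F x $ g)"
      using sym by (simp add: sum_distrib_left flip: mult.assoc)
    then show ?thesis
      unfolding expand[OF \<open>a \<noteq> b\<close> Lb] expand[OF \<open>a \<noteq> b\<close>[symmetric] La] comm
      by (simp add: mixed_partial_deriv(2)[OF U F \<open>a \<noteq> b\<close>] algebra_simps)
  qed
  then show ?thesis by (simp add: vec_eq_iff)
qed

section \<open>Commutators of matrices and tensor sites\<close>

lemma mscale_nth [simp]: "(z *\<^sub>M A) $ i $ j = z * A $ i $ j"
  by (simp add: mscale_def)

definition br :: "complex ^ 'm ^ 'm \<Rightarrow> complex ^ 'm ^ 'm \<Rightarrow> complex ^ ('m::finite) ^ 'm"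
  where "br A B = A ** B - B ** A"

lemma matrix_diff_ldistrib: "A ** (B - C) = A ** B - A ** (C :: complex ^ 'm ^ 'l)"
  by (simp add: vec_eq_iff matrix_matrix_mult_def right_diff_distrib sum_subtractf)

lemma matrix_diff_rdistrib: "(A - B) ** C = A ** C - B ** (C :: complex ^ 'm ^ 'l)"
  by (simp add: vec_eq_iff matrix_matrix_mult_def left_diff_distrib sum_subtractf)

lemma matrix_add_rdistrib: "(A + B) ** C = A ** C + B ** (C :: complex ^ 'm ^ 'l)"
  by (simp add: vec_eq_iff matrix_matrix_mult_def distrib_right sum.distrib)

lemma br_add_left: "br (A + B) C = br A C + br B C"
  by (simp add: br_def matrix_add_ldistrib matrix_add_rdistrib)

lemma br_add_right: "br A (B + C) = br A B + br A C"
  by (simp add: br_def matrix_add_ldistrib matrix_add_rdistrib)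

lemma br_diff_left: "br (A - B) C = br A C - br B C"
  by (simp add: br_def matrix_diff_ldistrib matrix_diff_rdistrib)

lemma br_diff_right: "br A (B - C) = br A B - br A C"
  by (simp add: br_def matrix_diff_ldistrib matrix_diff_rdistrib)

lemma br_swap: "br A B = - br B A"
  by (simp add: br_def)

lemma br_self [simp]: "br A A = 0"
  by (simp add: br_def)

lemma br_0_left [simp]: "br 0 A = 0"
  using br_diff_left[of 0 0 A] by simp

lemma br_0_right [simp]: "br A 0 = 0"
  using br_diff_right[of A 0 0] by simp

lemma br_minus_left: "br (- A) B = - br A B"
  using br_diff_left[of 0 A B] by simp

lemma br_minus_right: "br A (- B) = - br A B"
  using br_diff_right[of A 0 B] by simp

lemma mscale_mult_left: "(z *\<^sub>M A) ** B = z *\<^sub>M (A ** B)"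
  by (simp add: vec_eq_iff matrix_matrix_mult_def sum_distrib_left mult_ac)

lemma mscale_mult_right: "A ** (z *\<^sub>M B) = z *\<^sub>M (A ** B)"
  by (simp add: vec_eq_iff matrix_matrix_mult_def sum_distrib_left mult_ac)

lemma br_scale_left: "br (z *\<^sub>M A) B = z *\<^sub>M br A B"
  by (simp add: br_def mscale_mult_left mscale_mult_right vec_eq_iff right_diff_distrib)

lemma br_scale_right: "br A (z *\<^sub>M B) = z *\<^sub>M br A B"
  by (simp add: br_def mscale_mult_left mscale_mult_right vec_eq_iff right_diff_distrib)

lemma br_sum_left: "br (sum f S) B = (\<Sum>s\<in>S. br (f s) B)"
  by (induction S rule: infinite_finite_induct) (auto simp: br_add_left)

lemma br_sum_right: "br A (sum f S) = (\<Sum>s\<in>S. br A (f s))"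
  by (induction S rule: infinite_finite_induct) (auto simp: br_add_right)

lemmas br_linear = br_add_left br_add_right br_diff_left br_diff_right
  br_minus_left br_minus_right br_scale_left br_scale_right

lemma site_add: "site (u + v) j = site u j + site v j"
  by (auto simp: site_def vec_eq_iff)

lemma site_minus: "site (- u) j = - site u j"
  by (auto simp: site_def vec_eq_iff)

lemma site_0 [simp]: "site 0 j = 0"
  by (auto simp: site_def vec_eq_iff)

text \<open>Pure tensors include the basis vectors, and \<open>site\<close> acts on a pure tensor by
  updating one factor. Identities between products of \<open>site\<close> matrices thus become
  identities of function updates.\<close>

lemma matrix_eq_on_pure:
  fixes A B :: "('n::finite, 'N::finite) EndVT"
  assumes "\<And>t. A *v pure t = B *v pure t"
  shows "A = B"
proof -
  have col: "(C *v axis f 1) $ g = C $ g $ f" for C :: "('n, 'N) EndVT" and f g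
    by (simp add: matrix_vector_mult_def axis_def if_distrib cong: if_cong)
  show ?thesis
    using assms[of "\<lambda>j. axis (f j) 1" for f] by (simp add: vec_eq_iff pure_axis flip: col)
qed

lemma site_mult: "site u j ** site v j = site (u ** v) j"
  by (rule matrix_eq_on_pure) (simp add: site_pure flip: matrix_vector_mul_assoc)

lemma site_commute: "i \<noteq> j \<Longrightarrow> site u i ** site v j = site v j ** site u i"
  by (rule matrix_eq_on_pure) (simp add: site_pure fun_upd_twist flip: matrix_vector_mul_assoc)

lemma site_1 [simp]: "site (mat 1) j = mat 1"
  by (rule matrix_eq_on_pure) (simp add: site_pure)

lemma munit_mult: "munit a b ** munit c d = (if b = c then munit a d else 0)"
proof -
  have "(munit a b ** munit c d) $ p $ q = (\<Sum>r\<in>UNIV. if r = b then (if p = a \<and> b = c \<and> q = d then 1 else 0) else 0)" for p q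
    unfolding matrix_matrix_mult_def munit_def vec_lambda_beta by (rule sum.cong) auto
  then show ?thesis by (auto simp: vec_eq_iff munit_def)
qed

text \<open>A normal form on three positions: with \<open>mat 1\<close> filling the gaps, products
  are taken factor by factor (\<open>tensor3_mult\<close>), and a bracket reduces to products of
  matrix units.\<close>

definition tensor3 :: "'n::finite \<Rightarrow> 'n \<Rightarrow> 'n \<Rightarrow> 'N::finite EndV \<Rightarrow> 'N EndV \<Rightarrow> 'N EndV \<Rightarrow> ('n, 'N) EndVT"
  where "tensor3 i j l u v w = site u i ** site v j ** site w l"

lemma tensor3_mult:
  assumes "i \<noteq> j" "i \<noteq> l" "j \<noteq> l"
  shows "tensor3 i j l u v w ** tensor3 i j l u' v' w' = tensor3 i j l (u ** u') (v ** v') (w ** w')"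
  unfolding tensor3_def using assms
  by (intro matrix_eq_on_pure)
     (auto simp: site_pure fun_upd_twist simp flip: matrix_vector_mul_assoc)

lemma br_tensor3:
  assumes "i \<noteq> j" "i \<noteq> l" "j \<noteq> l"
  shows "br (tensor3 i j l u v w) (tensor3 i j l u' v' w') =
    tensor3 i j l (u ** u') (v ** v') (w ** w') - tensor3 i j l (u' ** u) (v' ** v) (w' ** w)"
  using assms by (simp add: br_def tensor3_mult)

lemma tensor3_linear:
  "tensor3 i j l (u + u') v w = tensor3 i j l u v w + tensor3 i j l u' v w"
  "tensor3 i j l u (v + v') w = tensor3 i j l u v w + tensor3 i j l u v' w"
  "tensor3 i j l u v (w + w') = tensor3 i j l u v w + tensor3 i j l u v w'"
  by (simp_all add: tensor3_def site_add matrix_add_ldistrib matrix_add_rdistrib)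

lemma matrix_mult_0 [simp]: "0 ** (A :: complex ^ 'm ^ 'l) = 0" "(A :: complex ^ 'm ^ 'l) ** 0 = 0"
  by (simp_all add: matrix_matrix_mult_def vec_eq_iff)

lemma tensor3_0 [simp]:
  "tensor3 i j l 0 v w = 0" "tensor3 i j l u 0 w = 0" "tensor3 i j l u v 0 = 0"
  by (simp_all add: tensor3_def)

lemma site_site_tensor3:
  assumes "i \<noteq> j" "i \<noteq> l" "j \<noteq> l"
  shows "site u i ** site v j = tensor3 i j l u v (mat 1)"
    "site u i ** site w l = tensor3 i j l u (mat 1) w"
    "site v j ** site w l = tensor3 i j l (mat 1) v w"
  by (simp_all add: tensor3_def)

section \<open>The bar involution and the operators \<open>X\<close> for all pairs of
  indices\<close>

fun bar :: "'N + 'N \<Rightarrow> 'N + 'N" where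
  "bar (Inl a) = Inr a"
| "bar (Inr a) = Inl a"

lemma bar_bar [simp]: "bar (bar p) = p" by (cases p) auto
lemma bar_neq [simp]: "bar p \<noteq> p" "p \<noteq> bar p" by (cases p; auto)+
lemma bar_inj [simp]: "bar p = bar q \<longleftrightarrow> p = q" by (metis bar_bar)
lemma bar_eq_swap: "bar p = q \<longleftrightarrow> p = bar q" by auto

text \<open>A deliberately small rewrite set for the larger identities: matrix units are multiplied
  out with it first, and the full simplifier only collects the surviving terms.\<close>

lemmas munit_simps = munit_mult bar_inj bar_neq if_True if_False simp_thms matrix_mul_lid matrix_mul_rid

definition ee :: "'N + 'N \<Rightarrow> 'N + 'N \<Rightarrow> ('N::finite) EndV"
  where "ee a b = munit a b + munit (bar a) (bar b)"

definition xx :: "'N + 'N \<Rightarrow> 'N + 'N \<Rightarrow> 'n \<Rightarrow> 'n \<Rightarrow> ('n::finite, 'N::finite) EndVT"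
  where "xx a b i j = site (munit a b) i ** site (ee b a) j
     + site (munit (bar b) (bar a)) i ** site (ee a b) j"

definition X :: "'N + 'N \<Rightarrow> 'N + 'N \<Rightarrow> ('n::{finite,linorder}, 'N::finite) EndVT"
  where "X a b = (\<Sum>(i, j)\<in>{(i, j). i < j}. xx a b i j)"

text \<open>The six ordered pairs of distinct two-element subsets of {i, j, l}: the part of a
  bracket of two pair sums that lives on exactly these three sites.\<close>

definition br3 :: "('n \<Rightarrow> 'n \<Rightarrow> complex ^ 'm ^ 'm) \<Rightarrow> ('n \<Rightarrow> 'n \<Rightarrow> complex ^ 'm ^ 'm) \<Rightarrow> 'n \<Rightarrow> 'n \<Rightarrow> 'n
    \<Rightarrow> complex ^ ('m::finite) ^ 'm"
  where "br3 f g i j l = br (f i j) (g i l) + br (f i j) (g j l) + br (f i l) (g i j)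
     + br (f i l) (g j l) + br (f j l) (g i j) + br (f j l) (g i l)"

lemma xx_tensor3:
  assumes "i \<noteq> j" "i \<noteq> l" "j \<noteq> l"
  shows "xx a b i j = tensor3 i j l (munit a b) (ee b a) (mat 1) + tensor3 i j l (munit (bar b) (bar a)) (ee a b) (mat 1)"
    "xx a b i l = tensor3 i j l (munit a b) (mat 1) (ee b a) + tensor3 i j l (munit (bar b) (bar a)) (mat 1) (ee a b)"
    "xx a b j l = tensor3 i j l (mat 1) (munit a b) (ee b a) + tensor3 i j l (mat 1) (munit (bar b) (bar a)) (ee a b)"
  using assms by (simp_all add: xx_def site_site_tensor3[OF assms])

definition indep :: "'N + 'N \<Rightarrow> 'N + 'N \<Rightarrow> bool"
  where "indep p q \<longleftrightarrow> p \<noteq> q \<and> p \<noteq> bar q"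

text \<open>Listed in every orientation and placement of \<open>bar\<close>, so that the simplifier
  can decide each index comparison arising from \<open>munit_mult\<close>.\<close>

lemma indep_neq:
  assumes "indep p q"
  shows "p \<noteq> q" "q \<noteq> p" "p \<noteq> bar q" "bar q \<noteq> p" "bar p \<noteq> q" "q \<noteq> bar p"
  using assms by (auto simp: indep_def)

lemma indep_sym: "indep p q \<Longrightarrow> indep q p"
  by (auto simp: indep_def)

lemma indep_bar [simp]: "indep (bar p) q \<longleftrightarrow> indep p q" "indep p (bar q) \<longleftrightarrow> indep p q"
  by (auto simp: indep_def)

definition tensor2 :: "'n::finite \<Rightarrow> 'n \<Rightarrow> 'N::finite EndV \<Rightarrow> 'N EndV \<Rightarrow> ('n, 'N) EndVT"
  where "tensor2 i j u v = site u i ** site v j"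

lemma br_tensor2:
  assumes "i \<noteq> j"
  shows "br (tensor2 i j u v) (tensor2 i j u' v') = tensor2 i j (u ** u') (v ** v') - tensor2 i j (u' ** u) (v' ** v)"
proof -
  have "tensor2 i j u v ** tensor2 i j u' v' = tensor2 i j (u ** u') (v ** v')" for u v u' v' :: "'b EndV"
    unfolding tensor2_def using assms
    by (intro matrix_eq_on_pure)
      (auto simp: site_pure fun_upd_twist simp flip: matrix_vector_mul_assoc)
  then show ?thesis by (simp add: br_def)
qed

lemma tensor2_linear:
  "tensor2 i j (u + u') v = tensor2 i j u v + tensor2 i j u' v"
  "tensor2 i j u (v + v') = tensor2 i j u v + tensor2 i j u v'"
  by (simp_all add: tensor2_def site_add matrix_add_ldistrib matrix_add_rdistrib)

lemma tensor2_0 [simp]: "tensor2 i j 0 v = 0" "tensor2 i j u 0 = 0"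
  by (simp_all add: tensor2_def)

lemma site_tensor2: "site u i = tensor2 i j u (mat 1)" "site u j = tensor2 i j (mat 1) u"
  by (simp_all add: tensor2_def)

text \<open>Two pairs of sites coincide, share exactly one site, or are disjoint. The first case
  gives the sum over pairs, the second the sum over sorted triples, and the third contributes
  nothing by \<open>disj\<close>.\<close>

lemma br_pair_sums:
  fixes f g :: "'n::{finite,linorder} \<Rightarrow> 'n \<Rightarrow> complex ^ ('m::finite) ^ 'm"
  assumes disj: "\<And>i j k l. i < j \<Longrightarrow> k < l \<Longrightarrow> i \<notin> {k, l} \<Longrightarrow> j \<notin> {k, l} \<Longrightarrow> br (f i j) (g k l) = 0"
  shows "br (\<Sum>(i, j)\<in>{(i, j). i < j}. f i j) (\<Sum>(i, j)\<in>{(i, j). i < j}. g i j) =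
    (\<Sum>(i, j)\<in>{(i, j). i < j}. br (f i j) (g i j)) +
    (\<Sum>(i, j, l)\<in>{(i, j, l). i < j \<and> j < l}. br3 f g i j l)"
proof -
  let ?P = "{(i, j). i < j} :: ('n \<times> 'n) set"
  let ?T = "{(i, j, l). i < j \<and> j < l} :: ('n \<times> 'n \<times> 'n) set"
  define F where "F = (\<lambda>((i, j), (k, l)). br (f i j) (g k l))"
  \<comment> \<open>\<open>d\<close> parametrises the coinciding pairs, \<open>h1\<close> to
    \<open>h6\<close> the six ways of choosing two distinct pairs from a sorted triple. Their images
    are disjoint and carry all nonzero summands.\<close>
  define d :: "'n \<times> 'n \<Rightarrow> ('n \<times> 'n) \<times> ('n \<times> 'n)" where "d = (\<lambda>p. (p, p))"
  define h1 :: "'n \<times> 'n \<times> 'n \<Rightarrow> ('n \<times> 'n) \<times> ('n \<times> 'n)" where "h1 = (\<lambda>(i, j, l). ((i, j), (i, l)))"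
  define h2 :: "'n \<times> 'n \<times> 'n \<Rightarrow> ('n \<times> 'n) \<times> ('n \<times> 'n)" where "h2 = (\<lambda>(i, j, l). ((i, j), (j, l)))"
  define h3 :: "'n \<times> 'n \<times> 'n \<Rightarrow> ('n \<times> 'n) \<times> ('n \<times> 'n)" where "h3 = (\<lambda>(i, j, l). ((i, l), (i, j)))"
  define h4 :: "'n \<times> 'n \<times> 'n \<Rightarrow> ('n \<times> 'n) \<times> ('n \<times> 'n)" where "h4 = (\<lambda>(i, j, l). ((i, l), (j, l)))"
  define h5 :: "'n \<times> 'n \<times> 'n \<Rightarrow> ('n \<times> 'n) \<times> ('n \<times> 'n)" where "h5 = (\<lambda>(i, j, l). ((j, l), (i, j)))"
  define h6 :: "'n \<times> 'n \<times> 'n \<Rightarrow> ('n \<times> 'n) \<times> ('n \<times> 'n)" where "h6 = (\<lambda>(i, j, l). ((j, l), (i, l)))"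
  note hs = h1_def h2_def h3_def h4_def h5_def h6_def
  have inj: "inj_on d ?P" "inj_on h1 ?T" "inj_on h2 ?T" "inj_on h3 ?T" "inj_on h4 ?T" "inj_on h5 ?T" "inj_on h6 ?T"
    by (auto simp: inj_on_def d_def hs)
  let ?S = "d ` ?P \<union> (h1 ` ?T \<union> (h2 ` ?T \<union> (h3 ` ?T \<union> (h4 ` ?T \<union> (h5 ` ?T \<union> h6 ` ?T)))))"
  have "br (\<Sum>(i, j)\<in>?P. f i j) (\<Sum>(i, j)\<in>?P. g i j) = (\<Sum>q\<in>?P \<times> ?P. F q)"
    by (subst br_sum_left) (simp add: br_sum_right F_def case_prod_unfold sum.cartesian_product)
  also have "\<dots> = sum F ?S"
  proof (rule sum.mono_neutral_right)
    show "\<forall>q\<in>?P \<times> ?P - ?S. F q = 0"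
    proof
      fix q assume q: "q \<in> ?P \<times> ?P - ?S"
      obtain i j k l where [simp]: "q = ((i, j), (k, l))" by (metis prod.exhaust)
      from q have lt: "i < j" "k < l" by auto
      have nd: "\<not> (i = k \<and> j = l)" using q lt by (auto simp: d_def)
      have n: "x \<in> ?T \<Longrightarrow> q \<noteq> h1 x \<and> q \<noteq> h2 x \<and> q \<noteq> h3 x \<and> q \<noteq> h4 x \<and> q \<noteq> h5 x \<and> q \<noteq> h6 x" for x
        using q by blast
      have "i \<noteq> k"
        using nd lt n[of "(i, j, l)"] n[of "(i, l, j)"] by (cases j l rule: linorder_cases) (auto simp: hs)
      moreover have "i \<noteq> l"
        using lt n[of "(k, i, j)"] by (auto simp: hs)
      moreover have "j \<noteq> k"
        using lt n[of "(i, j, l)"] by (auto simp: hs)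
      moreover have "j \<noteq> l"
        using nd lt n[of "(i, k, j)"] n[of "(k, i, j)"] by (cases i k rule: linorder_cases) (auto simp: hs)
      ultimately have "i \<notin> {k, l}" "j \<notin> {k, l}" by auto
      then show "F q = 0" using lt by (auto simp: F_def disj)
    qed
  qed (auto simp: d_def hs)
  also have "\<dots> = sum F (d ` ?P) + (sum F (h1 ` ?T) + (sum F (h2 ` ?T) + (sum F (h3 ` ?T)
      + (sum F (h4 ` ?T) + (sum F (h5 ` ?T) + sum F (h6 ` ?T))))))"
    by (subst sum.union_disjoint; (simp; fail)?; (auto simp: d_def hs; fail)?)+
  also have "\<dots> = (\<Sum>(i, j)\<in>?P. br (f i j) (g i j)) + (\<Sum>(i, j, l)\<in>?T. br3 f g i j l)"
    unfolding inj[THEN sum.reindex]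
    by (simp add: F_def d_def hs br3_def case_prod_unfold sum.distrib add_ac)
  finally show ?thesis .
qed

lemma br_site_pair_sums:
  fixes f :: "'n::{finite,linorder} \<Rightarrow> 'n \<Rightarrow> complex ^ ('m::finite) ^ 'm"
  assumes disj: "\<And>i j m. i < j \<Longrightarrow> m \<notin> {i, j} \<Longrightarrow> br (s m) (f i j) = 0"
  shows "br (\<Sum>m\<in>UNIV. s m) (\<Sum>(i, j)\<in>{(i, j). i < j}. f i j) =
    (\<Sum>(i, j)\<in>{(i, j). i < j}. br (s i + s j) (f i j))"
proof -
  have "br (\<Sum>m\<in>UNIV. s m) (f i j) = br (s i + s j) (f i j)" if "i < j" for i j
  proof -
    have "(\<Sum>m\<in>UNIV. br (s m) (f i j)) = (\<Sum>m\<in>{i, j}. br (s m) (f i j))"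
      by (rule sum.mono_neutral_right) (use disj that in auto)
    then show ?thesis using that by (simp add: br_sum_left br_add_left)
  qed
  then show ?thesis
    unfolding br_sum_right by (intro sum.cong) auto
qed

lemma xx_tensor2: "xx a b i j = tensor2 i j (munit a b) (ee b a) + tensor2 i j (munit (bar b) (bar a)) (ee a b)"
  by (simp add: xx_def tensor2_def)

lemma br_sites_disjoint:
  assumes "i \<notin> {k, l}" "j \<notin> {k, l}"
  shows "br (site u i ** site v j) (site u' k ** site v' l) = 0"
proof -
  have "(site u i ** site v j) ** (site u' k ** site v' l) = (site u' k ** site v' l) ** (site u i ** site v j)"
    using assms by (intro matrix_eq_on_pure)
      (auto simp: site_pure fun_upd_twist simp flip: matrix_vector_mul_assoc)
  then show ?thesis by (simp add: br_def)
qed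

lemma br_xx_disjoint: "i \<notin> {k, l} \<Longrightarrow> j \<notin> {k, l} \<Longrightarrow> br (xx a b i j) (xx c d k l) = 0"
  by (simp add: xx_def br_linear br_sites_disjoint)

lemma br_site_xx_disjoint: "m \<notin> {i, j} \<Longrightarrow> br (site u m) (xx a b i j) = 0"
  using br_sites_disjoint[of m i j m "mat 1" u] by (simp add: xx_def br_linear)

lemma br_X_X: "br (X a b) (X c d) = (\<Sum>(i, j)\<in>{(i, j). i < j}. br (xx a b i j) (xx c d i j)) +
    (\<Sum>(i, j, l)\<in>{(i, j, l). i < j \<and> j < l}. br3 (xx a b) (xx c d) i j l)"
  unfolding X_def by (rule br_pair_sums) (rule br_xx_disjoint)

section \<open>Identities on two and three sites\<close>

text \<open>With the three indices in different classes every product of matrix units is decided,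
  and the expanded monomials cancel. The relation contains no parameters and holds on two sites and
  on three sites separately.\<close>

lemma xx_yang_baxter3:
  assumes ne: "i \<noteq> j" "i \<noteq> l" "j \<noteq> l" and "indep a b" "indep a c" "indep b c"
  shows "br3 (xx a b) (xx b c) i j l + br3 (xx a b) (xx a c) i j l + br3 (xx a c) (xx b c) i j l = 0"
  using assms(4-)[THEN indep_neq(1)] assms(4-)[THEN indep_neq(2)] assms(4-)[THEN indep_neq(3)]
    assms(4-)[THEN indep_neq(4)] assms(4-)[THEN indep_neq(5)] assms(4-)[THEN indep_neq(6)]
  unfolding br3_def xx_tensor3[OF ne]
  by (simp add: br_linear br_tensor3[OF ne] ee_def tensor3_linear matrix_add_ldistrib matrix_add_rdistrib munit_mult)

lemma xx_yang_baxter2: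
  assumes ne: "i \<noteq> j" and "indep a b" "indep a c" "indep b c"
  shows "br (xx a b i j) (xx b c i j) + br (xx a b i j) (xx a c i j) + br (xx a c i j) (xx b c i j) = 0"
  using assms(2-)[THEN indep_neq(1)] assms(2-)[THEN indep_neq(2)] assms(2-)[THEN indep_neq(3)]
    assms(2-)[THEN indep_neq(4)] assms(2-)[THEN indep_neq(5)] assms(2-)[THEN indep_neq(6)]
  unfolding xx_tensor2
  by (simp add: br_linear br_tensor2[OF ne] ee_def tensor2_linear matrix_add_ldistrib matrix_add_rdistrib munit_mult)

text \<open>Twice a bracket is written as a sum, which keeps the identity purely additive when it is
  expanded into tensors.\<close>

lemma xx_reflection3:
  assumes ne: "i \<noteq> j" "i \<noteq> l" "j \<noteq> l" and "indep p q"
  shows "br3 (xx p (bar p)) (xx p q) i j l - br3 (xx p (bar p)) (xx p (bar q)) i j l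
    + br3 (xx q (bar q)) (xx p q) i j l + br3 (xx q (bar q)) (xx p (bar q)) i j l
    = br3 (xx p q) (xx p (bar q)) i j l + br3 (xx p q) (xx p (bar q)) i j l"
  using indep_neq[OF \<open>indep p q\<close>]
  unfolding br3_def xx_tensor3[OF ne]
  by (simp only: br_linear ee_def tensor3_linear bar_bar,
    simp only: br_tensor3[OF ne] tensor3_0 munit_simps, simp)

lemma xx_reflection2:
  assumes ne: "i \<noteq> j" and "indep p q"
  shows "br (xx p (bar p) i j) (xx p q i j) - br (xx p (bar p) i j) (xx p (bar q) i j)
    + br (xx q (bar q) i j) (xx p q i j) + br (xx q (bar q) i j) (xx p (bar q) i j)
    = br (xx p q i j) (xx p (bar q) i j) + br (xx p q i j) (xx p (bar q) i j)"
  using indep_neq[OF \<open>indep p q\<close>]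
  unfolding xx_tensor2
  by (simp only: br_linear ee_def tensor2_linear bar_bar,
    simp only: br_tensor2[OF ne] tensor2_0 munit_simps, simp)

text \<open>Let s = \<open>ee p (bar p)\<close>, which exchanges v_p and v_(bar p). Then
  \<open>xx p (bar p) + xx (bar p) p\<close> is 2 s^(i) s^(j). Summed over pairs this is the square
  of the total of s minus the total of s^2. Both totals commute with
  \<open>X p q + X (bar p) q\<close>: the first as in \<open>site_munit_reflection_sym\<close>, the
  second because it counts the factors in the span of v_p and v_(bar p).\<close>

lemma xx_reflection_sym3:
  assumes ne: "i \<noteq> j" "i \<noteq> l" "j \<noteq> l" and "indep p q"
  shows "br3 (xx p (bar p)) (xx p q) i j l + br3 (xx p (bar p)) (xx (bar p) q) i j l
    + br3 (xx (bar p) p) (xx p q) i j l + br3 (xx (bar p) p) (xx (bar p) q) i j l = 0"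
  using indep_neq[OF \<open>indep p q\<close>]
  unfolding br3_def xx_tensor3[OF ne]
  by (simp only: br_linear ee_def tensor3_linear bar_bar,
    simp only: br_tensor3[OF ne] tensor3_0 munit_simps, simp)

lemma xx_reflection_sym2:
  assumes ne: "i \<noteq> j" and "indep p q"
  shows "br (xx p (bar p) i j) (xx p q i j) + br (xx p (bar p) i j) (xx (bar p) q i j)
    + br (xx (bar p) p i j) (xx p q i j) + br (xx (bar p) p i j) (xx (bar p) q i j) = 0"
  using indep_neq[OF \<open>indep p q\<close>]
  unfolding xx_tensor2
  by (simp only: br_linear ee_def tensor2_linear bar_bar,
    simp only: br_tensor2[OF ne] tensor2_0 munit_simps, simp)

text \<open>Every product already vanishes at a shared site, since matrix units with indices from
  different classes multiply to 0.\<close>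

lemma br_xx_indep2:
  assumes ne: "i \<noteq> j" and "indep a c" "indep a d" "indep b c" "indep b d"
  shows "br (xx a b i j) (xx c d i j) = 0"
  using assms(2-)[THEN indep_neq(1)] assms(2-)[THEN indep_neq(2)] assms(2-)[THEN indep_neq(3)]
    assms(2-)[THEN indep_neq(4)] assms(2-)[THEN indep_neq(5)] assms(2-)[THEN indep_neq(6)]
  unfolding xx_tensor2
  by (simp only: br_linear ee_def tensor2_linear bar_bar,
    simp only: br_tensor2[OF ne] tensor2_0 munit_simps, simp)

lemma br_xx_indep3:
  assumes ne: "i \<noteq> j" "i \<noteq> l" "j \<noteq> l" and "indep a c" "indep a d" "indep b c" "indep b d"
  shows "br3 (xx a b) (xx c d) i j l = 0"
  using assms(4-)[THEN indep_neq(1)] assms(4-)[THEN indep_neq(2)] assms(4-)[THEN indep_neq(3)]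
    assms(4-)[THEN indep_neq(4)] assms(4-)[THEN indep_neq(5)] assms(4-)[THEN indep_neq(6)]
  unfolding br3_def xx_tensor3[OF ne]
  by (simp only: br_linear ee_def tensor3_linear bar_bar,
    simp only: br_tensor3[OF ne] tensor3_0 munit_simps, simp)

lemma site_xx_indep:
  assumes ne: "i \<noteq> j" and "indep a c" "indep a d" "indep b c" "indep b d"
  shows "br (site (munit a b) i) (xx c d i j) = 0" "br (site (munit a b) j) (xx c d i j) = 0"
  using assms(2-)[THEN indep_neq(1)] assms(2-)[THEN indep_neq(2)] assms(2-)[THEN indep_neq(3)]
    assms(2-)[THEN indep_neq(4)] assms(2-)[THEN indep_neq(5)] assms(2-)[THEN indep_neq(6)]
  unfolding xx_tensor2
  unfolding site_tensor2(1)[of _ i j] site_tensor2(2)[of _ j i]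
  by (simp_all only: br_linear ee_def tensor2_linear bar_bar,
    simp_all only: br_tensor2[OF ne] tensor2_0 munit_simps, simp_all)

text \<open>The left side is that of \<open>xx_reflection2\<close> with a one-site operator in place
  of \<open>xx p (bar p)\<close>, and the right side is 0. So the alpha-term can be added to
  \<open>X p (bar p)\<close> without changing the reflection relation.\<close>

lemma site_munit_reflection:
  assumes ne: "i \<noteq> j" and "indep p q"
  shows "br (site (munit p (bar p)) i + site (munit p (bar p)) j) (xx p q i j)
    - br (site (munit p (bar p)) i + site (munit p (bar p)) j) (xx p (bar q) i j)
    + br (site (munit q (bar q)) i + site (munit q (bar q)) j) (xx p q i j)
    + br (site (munit q (bar q)) i + site (munit q (bar q)) j) (xx p (bar q) i j) = 0"
  using indep_neq[OF \<open>indep p q\<close>]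
  unfolding xx_tensor2
  unfolding site_tensor2(1)[of _ i j] site_tensor2(2)[of _ j i]
  by (simp only: br_linear ee_def tensor2_linear bar_bar,
    simp only: br_tensor2[OF ne] tensor2_0 munit_simps, simp)

text \<open>This is the bracket of s^(i) + s^(j), s = \<open>ee p (bar p)\<close>, with
  \<open>xx p q + xx (bar p) q\<close>. Bracketing with s sends e_pq to e_(bar p)q and E_qp to
  -E_q(bar p), so the contributions of the two sites cancel.\<close>

lemma site_munit_reflection_sym:
  assumes ne: "i \<noteq> j" and "indep p q"
  shows "br (site (munit p (bar p)) i + site (munit p (bar p)) j) (xx p q i j)
    + br (site (munit p (bar p)) i + site (munit p (bar p)) j) (xx (bar p) q i j)
    + br (site (munit (bar p) p) i + site (munit (bar p) p) j) (xx p q i j)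
    + br (site (munit (bar p) p) i + site (munit (bar p) p) j) (xx (bar p) q i j) = 0"
  using indep_neq[OF \<open>indep p q\<close>]
  unfolding xx_tensor2
  unfolding site_tensor2(1)[of _ i j] site_tensor2(2)[of _ j i]
  by (simp only: br_linear ee_def tensor2_linear bar_bar,
    simp only: br_tensor2[OF ne] tensor2_0 munit_simps, simp)

text \<open>\<open>xx p q + xx q p\<close> is E_pq^(i) E_qp^(j) + E_qp^(i) E_pq^(j) with E =
  \<open>ee\<close>, and E_pq, E_qp commute with the bar exchange
  \<open>ee p (bar p) + ee q (bar q)\<close>. This serves the beta-term.\<close>

lemma site_ee_reflection_sym:
  assumes ne: "i \<noteq> j" and "indep p q"
  shows "br (site (ee p (bar p)) i + site (ee p (bar p)) j) (xx p q i j)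
    + br (site (ee p (bar p)) i + site (ee p (bar p)) j) (xx q p i j)
    + br (site (ee q (bar q)) i + site (ee q (bar q)) j) (xx p q i j)
    + br (site (ee q (bar q)) i + site (ee q (bar q)) j) (xx q p i j) = 0"
  using indep_neq[OF \<open>indep p q\<close>]
  unfolding xx_tensor2
  unfolding site_tensor2(1)[of _ i j] site_tensor2(2)[of _ j i]
  by (simp only: br_linear ee_def tensor2_linear bar_bar,
    simp only: br_tensor2[OF ne] tensor2_0 munit_simps, simp)

text \<open>The operator only moves p to q or back and bar p to bar q or back, and \<open>h\<close>
  is constant on each of these pairs. Vanishing at each site separately is what permits arbitrary
  weights y_j later.\<close>

lemma site_weight_xx:
  assumes ne: "i \<noteq> j" and "indep p q"
  defines "h \<equiv> munit p p + munit q q - (munit (bar p) (bar p) + munit (bar q) (bar q))"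
  shows "br (site h i) (xx p q i j) = 0" "br (site h j) (xx p q i j) = 0"
proof -
  have u: "munit p q ** h = h ** munit p q" "munit (bar q) (bar p) ** h = h ** munit (bar q) (bar p)"
     "ee p q ** h = h ** ee p q" "ee q p ** h = h ** ee q p"
    using indep_neq[OF \<open>indep p q\<close>]
    by (simp_all add: h_def ee_def matrix_add_ldistrib matrix_add_rdistrib matrix_diff_ldistrib matrix_diff_rdistrib munit_mult)
  show "br (site h i) (xx p q i j) = 0" "br (site h j) (xx p q i j) = 0"
    unfolding xx_tensor2
    unfolding site_tensor2(1)[of _ i j] site_tensor2(2)[of _ j i]
    by (simp_all add: br_linear br_tensor2[OF ne] u)
qed

section \<open>Commutation relations of the operators \<open>X\<close>\<close>

text \<open>By \<open>br_X_X\<close> the bracket splits into a two-site and a three-site sum, and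
  each vanishes term by term. The next relations between the \<open>X\<close> follow the same
  pattern.\<close>

lemma X_yang_baxter:
  assumes "indep a b" "indep a c" "indep b c"
  shows "br (X a b) (X b c) + br (X a b) (X a c) + br (X a c) (X b c) = (0 :: ('n::{finite,linorder}, 'N::finite) EndVT)"
proof -
  have 2: "(\<Sum>(i, j)\<in>{(i, j). i < j}. br (xx a b i j) (xx b c i j) + br (xx a b i j) (xx a c i j)
      + br (xx a c i j) (xx b c i j)) = (0 :: ('n, 'N) EndVT)"
    by (intro sum.neutral) (auto simp: xx_yang_baxter2[OF less_imp_neq] assms)
  have 3: "(\<Sum>(i, j, l)\<in>{(i, j, l). i < j \<and> j < l}. br3 (xx a b) (xx b c) i j l
      + br3 (xx a b) (xx a c) i j l + br3 (xx a c) (xx b c) i j l) = (0 :: ('n, 'N) EndVT)"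
    by (intro sum.neutral) (auto simp: xx_yang_baxter3[OF less_imp_neq less_imp_neq less_imp_neq] assms)
  show ?thesis
    using arg_cong2[OF 2 3, of "(+)"] by (simp add: br_X_X case_prod_unfold sum.distrib add_ac)
qed

lemma X_reflection:
  assumes "indep p q"
  shows "br (X p (bar p)) (X p q) - br (X p (bar p)) (X p (bar q))
    + br (X q (bar q)) (X p q) + br (X q (bar q)) (X p (bar q))
    - (br (X p q) (X p (bar q)) + br (X p q) (X p (bar q))) = (0 :: ('n::{finite,linorder}, 'N::finite) EndVT)"
proof -
  have 2: "(\<Sum>(i, j)\<in>{(i, j). i < j}. br (xx p (bar p) i j) (xx p q i j) - br (xx p (bar p) i j) (xx p (bar q) i j)
    + br (xx q (bar q) i j) (xx p q i j) + br (xx q (bar q) i j) (xx p (bar q) i j)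
    - (br (xx p q i j) (xx p (bar q) i j) + br (xx p q i j) (xx p (bar q) i j))) = (0 :: ('n, 'N) EndVT)"
    by (intro sum.neutral) (auto simp: xx_reflection2[OF less_imp_neq] assms)
  have 3: "(\<Sum>(i, j, l)\<in>{(i, j, l). i < j \<and> j < l}. br3 (xx p (bar p)) (xx p q) i j l
    - br3 (xx p (bar p)) (xx p (bar q)) i j l
    + br3 (xx q (bar q)) (xx p q) i j l + br3 (xx q (bar q)) (xx p (bar q)) i j l
    - (br3 (xx p q) (xx p (bar q)) i j l + br3 (xx p q) (xx p (bar q)) i j l)) = (0 :: ('n, 'N) EndVT)"
    by (intro sum.neutral) (auto simp: xx_reflection3[OF less_imp_neq less_imp_neq less_imp_neq] assms)
  show ?thesis
    using arg_cong2[OF 2 3, of "(+)"]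
    by (simp add: br_X_X case_prod_unfold sum.distrib sum_subtractf sum_distrib_left algebra_simps)
qed

lemma X_reflection_sym:
  assumes "indep p q"
  shows "br (X p (bar p)) (X p q) + br (X p (bar p)) (X (bar p) q)
    + br (X (bar p) p) (X p q) + br (X (bar p) p) (X (bar p) q) = (0 :: ('n::{finite,linorder}, 'N::finite) EndVT)"
proof -
  have 2: "(\<Sum>(i, j)\<in>{(i, j). i < j}. br (xx p (bar p) i j) (xx p q i j) + br (xx p (bar p) i j) (xx (bar p) q i j)
    + br (xx (bar p) p i j) (xx p q i j) + br (xx (bar p) p i j) (xx (bar p) q i j)) = (0 :: ('n, 'N) EndVT)"
    by (intro sum.neutral) (auto simp: xx_reflection_sym2[OF less_imp_neq] assms)
  have 3: "(\<Sum>(i, j, l)\<in>{(i, j, l). i < j \<and> j < l}. br3 (xx p (bar p)) (xx p q) i j l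
    + br3 (xx p (bar p)) (xx (bar p) q) i j l
    + br3 (xx (bar p) p) (xx p q) i j l + br3 (xx (bar p) p) (xx (bar p) q) i j l) = (0 :: ('n, 'N) EndVT)"
    by (intro sum.neutral) (auto simp: xx_reflection_sym3[OF less_imp_neq less_imp_neq less_imp_neq] assms)
  show ?thesis
    using arg_cong2[OF 2 3, of "(+)"] by (simp add: br_X_X case_prod_unfold sum.distrib add_ac)
qed

lemma X_disjoint:
  assumes "indep a c" "indep a d" "indep b c" "indep b d"
  shows "br (X a b) (X c d) = (0 :: ('n::{finite,linorder}, 'N::finite) EndVT)"
proof -
  have 2: "(\<Sum>(i, j)\<in>{(i, j). i < j}. br (xx a b i j) (xx c d i j)) = (0 :: ('n, 'N) EndVT)"
    by (intro sum.neutral) (auto simp: br_xx_indep2[OF less_imp_neq] assms)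
  have 3: "(\<Sum>(i, j, l)\<in>{(i, j, l). i < j \<and> j < l}. br3 (xx a b) (xx c d) i j l) = (0 :: ('n, 'N) EndVT)"
    by (intro sum.neutral) (auto simp: br_xx_indep3[OF less_imp_neq less_imp_neq less_imp_neq] assms)
  show ?thesis using 2 3 by (simp add: br_X_X)
qed

section \<open>Weighted one-site sums: weights y_j for the y-part, weight 1 for the alpha- and
  beta-parts\<close>

definition wsite :: "('n \<Rightarrow> complex) \<Rightarrow> 'N EndV \<Rightarrow> ('n::finite, 'N::finite) EndVT"
  where "wsite z u = (\<Sum>m\<in>UNIV. z m *\<^sub>M site u m)"

lemma mscale_add: "z *\<^sub>M (A + B) = z *\<^sub>M A + z *\<^sub>M B"
  by (simp add: vec_eq_iff algebra_simps)

lemma mscale_0 [simp]: "z *\<^sub>M 0 = 0"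
  by (simp add: vec_eq_iff)

lemma mscale_1 [simp]: "1 *\<^sub>M A = A"
  by (simp add: vec_eq_iff)

lemma mscale_minus: "z *\<^sub>M (- A) = - (z *\<^sub>M A)"
  by (simp add: vec_eq_iff)

lemma wsite_add: "wsite z (u + v) = wsite z u + wsite z v"
  by (simp add: wsite_def site_add mscale_add sum.distrib)

lemma wsite_minus: "wsite z (- u) = - wsite z u"
  by (simp add: wsite_def site_minus mscale_minus sum_negf)

lemma wsite_diff: "wsite z (u - v) = wsite z u - wsite z v"
  using wsite_add[of z u "- v"] by (simp add: wsite_minus)

lemma br_wsite_X:
  fixes a b :: "'N::finite + 'N" and z :: "'n::{finite,linorder} \<Rightarrow> complex"
  shows "br (wsite z u) (X a b) = (\<Sum>(i, j)\<in>{(i, j). i < j}. br (z i *\<^sub>M site u i + z j *\<^sub>M site u j) (xx a b i j))"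
  unfolding wsite_def X_def
  by (rule br_site_pair_sums) (simp add: br_scale_left br_site_xx_disjoint)

lemma br_wsite_X_eq_0:
  fixes a b :: "'N::finite + 'N" and z :: "'n::{finite,linorder} \<Rightarrow> complex"
  assumes "\<And>i j. i \<noteq> j \<Longrightarrow> br (site u i) (xx a b i j) = (0 :: ('n, 'N) EndVT)"
    and "\<And>i j. i \<noteq> j \<Longrightarrow> br (site u j) (xx a b i j) = (0 :: ('n, 'N) EndVT)"
  shows "br (wsite z u) (X a b) = 0"
  unfolding br_wsite_X using assms by (intro sum.neutral) (auto simp: br_add_left br_scale_left)

lemma wsite_X_disjoint:
  assumes "indep a c" "indep a d" "indep b c" "indep b d"
  shows "br (wsite z (munit a b)) (X c d) = 0"
  using assms by (intro br_wsite_X_eq_0 site_xx_indep)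

lemma wsite_X_weight:
  assumes "indep p q"
  shows "br (wsite z (munit p p + munit q q - (munit (bar p) (bar p) + munit (bar q) (bar q)))) (X p q) = 0"
  using assms by (intro br_wsite_X_eq_0 site_weight_xx)

lemma br_wsite_wsite:
  fixes u v :: "'N::finite EndV"
  assumes "u ** v = 0" "v ** u = 0"
  shows "br (wsite z u) (wsite w v) = (0 :: ('n::finite, 'N) EndVT)"
proof -
  have "br (site u i) (site v j) = (0 :: ('n, 'N) EndVT)" for i j
    using assms by (cases "i = j") (auto simp: br_def site_mult site_commute)
  then show ?thesis by (simp add: wsite_def br_sum_left br_sum_right br_scale_left br_scale_right)
qed

abbreviation T :: "'N + 'N \<Rightarrow> ('n::finite, 'N::finite) EndVT"
  where "T p \<equiv> wsite (\<lambda>_. 1) (munit p (bar p))"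

lemma T_reflection:
  assumes "indep p q"
  shows "br (T p) (X p q) - br (T p) (X p (bar q)) + br (T q) (X p q) + br (T q) (X p (bar q))
    = (0 :: ('n::{finite,linorder}, 'N::finite) EndVT)"
proof -
  have "(\<Sum>(i, j)\<in>{(i, j). i < j}. br (site (munit p (bar p)) i + site (munit p (bar p)) j) (xx p q i j)
    - br (site (munit p (bar p)) i + site (munit p (bar p)) j) (xx p (bar q) i j)
    + br (site (munit q (bar q)) i + site (munit q (bar q)) j) (xx p q i j)
    + br (site (munit q (bar q)) i + site (munit q (bar q)) j) (xx p (bar q) i j)) = (0 :: ('n, 'N) EndVT)"
    by (intro sum.neutral) (auto simp: site_munit_reflection[OF less_imp_neq] assms)
  then show ?thesis
    by (simp add: br_wsite_X case_prod_unfold sum.distrib sum_subtractf)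
qed

lemma T_reflection_sym:
  assumes "indep p q"
  shows "br (T p) (X p q) + br (T p) (X (bar p) q) + br (T (bar p)) (X p q) + br (T (bar p)) (X (bar p) q)
    = (0 :: ('n::{finite,linorder}, 'N::finite) EndVT)"
proof -
  have "(\<Sum>(i, j)\<in>{(i, j). i < j}. br (site (munit p (bar p)) i + site (munit p (bar p)) j) (xx p q i j)
    + br (site (munit p (bar p)) i + site (munit p (bar p)) j) (xx (bar p) q i j)
    + br (site (munit (bar p) p) i + site (munit (bar p) p) j) (xx p q i j)
    + br (site (munit (bar p) p) i + site (munit (bar p) p) j) (xx (bar p) q i j)) = (0 :: ('n, 'N) EndVT)"
    by (intro sum.neutral) (auto simp: site_munit_reflection_sym[OF less_imp_neq] assms)
  then show ?thesis
    by (simp add: br_wsite_X case_prod_unfold sum.distrib sum_subtractf)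
qed

abbreviation TT :: "'N + 'N \<Rightarrow> ('n::finite, 'N::finite) EndVT"
  where "TT p \<equiv> wsite (\<lambda>_. 1) (ee p (bar p))"

lemma TT_X:
  assumes "indep p q"
  shows "br (TT p) (X p q) + br (TT p) (X q p) + br (TT q) (X p q) + br (TT q) (X q p)
    = (0 :: ('n::{finite,linorder}, 'N::finite) EndVT)"
proof -
  have "(\<Sum>(i, j)\<in>{(i, j). i < j}. br (site (ee p (bar p)) i + site (ee p (bar p)) j) (xx p q i j)
    + br (site (ee p (bar p)) i + site (ee p (bar p)) j) (xx q p i j)
    + br (site (ee q (bar q)) i + site (ee q (bar q)) j) (xx p q i j)
    + br (site (ee q (bar q)) i + site (ee q (bar q)) j) (xx q p i j)) = (0 :: ('n, 'N) EndVT)"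
    by (intro sum.neutral) (auto simp: site_ee_reflection_sym[OF less_imp_neq] assms)
  then show ?thesis
    by (simp add: br_wsite_X case_prod_unfold sum.distrib sum_subtractf)
qed

lemma ee_bar: "ee (bar a) (bar b) = ee a b"
  by (simp add: ee_def add.commute)

lemma X_bar: "X (bar b) (bar a) = X a b"
  by (simp add: X_def xx_def ee_bar add.commute)

section \<open>The classical Yang-Baxter equation and the reflection equation\<close>

text \<open>Here \<open>p\<close>, \<open>q\<close>, \<open>r\<close> stand for entries of the commutators of \<open>(X\<^bsub>ab\<^esub>, X\<^bsub>bc\<^esub>)\<close>, \<open>(X\<^bsub>ab\<^esub>, X\<^bsub>ac\<^esub>)\<close>,
  \<open>(X\<^bsub>ac\<^esub>, X\<^bsub>bc\<^esub>)\<close>, numbered by which of the two factors have their indices transposed; the hypotheses are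
  the six permutations of \<open>X_yang_baxter\<close>.\<close>

lemma yang_baxter_coefficients:
  fixes a b c :: complex
  assumes ne: "a \<noteq> b" "a \<noteq> c" "b \<noteq> c"
    and eqs: "p1 + q1 + r1 = 0" "r2 - q1 + p2 = 0" "q3 + p3 - r1 = 0" "q4 - r3 - p3 = 0" "r4 - q2 - p2 = 0" "p4 + r4 + q4 = 0"
  shows "(a * (b * p1 + c * p2) + b * (b * p3 + c * p4)) / ((a - b) * (b - c))
    + (a * (a * q1 + c * q2) + b * (a * q3 + c * q4)) / ((a - b) * (a - c))
    + (a * (b * r1 + c * r2) + c * (b * r3 + c * r4)) / ((a - c) * (b - c)) = 0"
proof -
  \<comment> \<open>One unknown is eliminated per relation; what remains is a rational identity with
    p2, p3, q1, q4, r1, r4 free.\<close>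
  have s: "p1 = - q1 - r1" "r2 = q1 - p2" "q3 = r1 - p3" "r3 = q4 - p3" "q2 = r4 - p2" "p4 = - r4 - q4"
    using eqs by algebra+
  show ?thesis
    unfolding s using ne by (simp add: divide_simps) (simp add: algebra_simps)
qed

text \<open>A common denominator with the four factors kept atomic, so that \<open>algebra\<close>
  meets only a polynomial identity.\<close>

lemma add_fracs_pairwise:
  fixes A B C D n1 n2 n3 n4 :: complex
  assumes "A \<noteq> 0" "B \<noteq> 0" "C \<noteq> 0" "D \<noteq> 0"
  shows "n1 / (A * C) - n2 / (A * D) + n3 / (B * C) + n4 / (B * D) =
    (n1 * (B * D) - n2 * (B * C) + n3 * (A * D) + n4 * (A * C)) / (A * B * C * D)"
  using assms by (simp add: add_divide_distrib diff_divide_distrib)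

text \<open>The letters \<open>A\<close>, \<open>D\<close>, \<open>B\<close>, \<open>E\<close> stand for commutators with the operators \<open>tau\<close> below at \<open>a\<close>, \<open>bar a\<close>, \<open>b\<close>, \<open>bar b\<close>, and
  \<open>s\<close>, \<open>s'\<close>, \<open>t\<close>, \<open>t'\<close> for the second entries \<open>X a b\<close>, \<open>X b a\<close>, \<open>X a (bar b)\<close>, \<open>X (bar b) a\<close>;
  thus \<open>st\<close> is the commutator of \<open>X a b\<close> and \<open>X a (bar b)\<close>, up to the factor \<open>k\<close>.\<close>

lemma reflection_coefficients:
  fixes u v :: complex
  assumes ne: "u\<^sup>2 \<noteq> 1" "v\<^sup>2 \<noteq> 1" "u \<noteq> v" "u * v \<noteq> 1"
    and E: "As - At + Bs + Bt = 2 * st" "Bs' - Bt + As' + At = 2 * s't"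
      "Ds' - Dt' + Es' + Et' = 2 * s't'" "Es - Et' + Ds + Dt' = 2 * st'"
    and S: "As + At' + Ds + Dt' = 0" "At + As' + Dt + Ds' = 0"
      "Bs' + Bt' + Es' + Et' = 0" "Bt + Bs + Et + Es = 0"
  shows "(u\<^sup>2 * (u * As + v * As') + (u * Ds + v * Ds')) / ((u\<^sup>2 - 1) * (u - v))
    - (u\<^sup>2 * (u * v * At + At') + (u * v * Dt + Dt')) / ((u\<^sup>2 - 1) * (u * v - 1))
    + (v\<^sup>2 * (u * Bs + v * Bs') + (u * Es + v * Es')) / ((v\<^sup>2 - 1) * (u - v))
    + (v\<^sup>2 * (u * v * Bt + Bt') + (u * v * Et + Et')) / ((v\<^sup>2 - 1) * (u * v - 1))
    = 2 * (u * (u * v * st + st') + v * (u * v * s't + s't')) / ((u - v) * (u * v - 1))"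
proof -
  have s1: "Bs = 2 * st - As + At - Bt" "Bs' = 2 * s't + Bt - As' - At"
    "Es' = 2 * s't' - Ds' + Dt' - Et'" "Es = 2 * st' + Et' - Ds - Dt'"
    using E by (simp_all add: algebra_simps)
  have s2: "Bt' = - Bs' - Es' - Et'" "Et = - Bt - Bs - Es"
    using S(3,4) by algebra+
  have s3: "As = - At' - Ds - Dt'" "As' = - At - Dt - Ds'"
    using S(1,2) by algebra+
  have rhs: "2 * n / (C * D) = 2 * n * (A * B) / (A * B * C * D)"
    if "A \<noteq> 0" "B \<noteq> 0" for A B C D n :: complex
    using that by simp
  have "(u\<^sup>2 * (u * As + v * As') + (u * Ds + v * Ds')) * ((v\<^sup>2 - 1) * (u * v - 1))
    - (u\<^sup>2 * (u * v * At + At') + (u * v * Dt + Dt')) * ((v\<^sup>2 - 1) * (u - v))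
    + (v\<^sup>2 * (u * Bs + v * Bs') + (u * Es + v * Es')) * ((u\<^sup>2 - 1) * (u * v - 1))
    + (v\<^sup>2 * (u * v * Bt + Bt') + (u * v * Et + Et')) * ((u\<^sup>2 - 1) * (u - v))
    = 2 * (u * (u * v * st + st') + v * (u * v * s't + s't')) * ((u\<^sup>2 - 1) * (v\<^sup>2 - 1))"
    \<comment> \<open>The order matters: the right sides of \<open>s2\<close> contain letters
      eliminated by \<open>s1\<close>, and those of \<open>s1\<close> contain letters eliminated by
      \<open>s3\<close>.\<close>
    unfolding s2 unfolding s1 unfolding s3 by algebra
  then show ?thesis
    using ne add_fracs_pairwise[of "u\<^sup>2 - 1" "v\<^sup>2 - 1" "u - v" "u * v - 1"] rhs[of "u\<^sup>2 - 1" "v\<^sup>2 - 1"]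
    by (simp only: right_minus_eq not_False_eq_True simp_thms)
qed

text \<open>The counterpart for the beta-term: \<open>A\<close> and \<open>B\<close> now stand for
  brackets with \<open>TT a\<close> and \<open>TT b\<close>. As \<open>TT\<close> is invariant under
  \<open>bar\<close>, the letters \<open>D\<close> and \<open>E\<close> disappear. The first four
  relations come from \<open>T_reflection_sym\<close>, the last from \<open>TT_X\<close>.\<close>

lemma reflection_sym_coefficients:
  fixes u v :: complex
  assumes ne: "u\<^sup>2 \<noteq> 1" "v\<^sup>2 \<noteq> 1" "u \<noteq> v" "u * v \<noteq> 1"
    and S: "As + At' = 0" "At + As' = 0" "Bs' + Bt' = 0" "Bt + Bs = 0" "As + As' + Bs + Bs' = 0"
  shows "u * (u * As + v * As') / ((u\<^sup>2 - 1) * (u - v)) - u * (u * v * At + At') / ((u\<^sup>2 - 1) * (u * v - 1))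
    + v * (u * Bs + v * Bs') / ((v\<^sup>2 - 1) * (u - v)) + v * (u * v * Bt + Bt') / ((v\<^sup>2 - 1) * (u * v - 1)) = 0"
proof -
  have s: "At' = - As" "At = - As'" "Bt' = - Bs'" "Bt = - Bs" "Bs' = - As - As' - Bs"
    using S by algebra+
  have "u * (u * As + v * As') * ((v\<^sup>2 - 1) * (u * v - 1)) - u * (u * v * At + At') * ((v\<^sup>2 - 1) * (u - v))
      + v * (u * Bs + v * Bs') * ((u\<^sup>2 - 1) * (u * v - 1)) + v * (u * v * Bt + Bt') * ((u\<^sup>2 - 1) * (u - v)) = 0"
    unfolding s(1-4) unfolding s(5) by algebra
  then show ?thesis
    using ne add_fracs_pairwise[of "u\<^sup>2 - 1" "v\<^sup>2 - 1" "u - v" "u * v - 1"]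
    by (simp only: right_minus_eq not_False_eq_True simp_thms div_0)
qed

definition R :: "('N + 'N \<Rightarrow> complex) \<Rightarrow> 'N + 'N \<Rightarrow> 'N + 'N \<Rightarrow> ('n::{finite,linorder}, 'N::finite) EndVT"
  where "R \<xi> p q = (1 / (\<xi> p - \<xi> q)) *\<^sub>M (\<xi> p *\<^sub>M X p q + \<xi> q *\<^sub>M X q p)"

text \<open>\<open>X p (bar p)\<close> and \<open>T p\<close> have proportional coefficients in
  \<open>W\<close>, so they are treated as one operator.\<close>

definition tau :: "complex \<Rightarrow> complex \<Rightarrow> 'N + 'N \<Rightarrow> ('n::{finite,linorder}, 'N::finite) EndVT"
  where "tau k \<alpha> p = k *\<^sub>M X p (bar p) + (2 * \<alpha>) *\<^sub>M T p"

text \<open>Collects the p = a terms of the Y- and Z-sums with the alpha- and beta-terms over one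
  denominator. For instance 2 alpha T + 2 alpha (T + T') / (x^2 - 1) = 2 alpha (x^2 T + T') / (x^2 -
  1), T' being \<open>T\<close> at the barred index.\<close>

definition W :: "complex \<Rightarrow> complex \<Rightarrow> complex \<Rightarrow> ('N + 'N \<Rightarrow> complex) \<Rightarrow> 'N + 'N \<Rightarrow>
    ('n::{finite,linorder}, 'N::finite) EndVT"
  where "W k \<alpha> \<beta> \<xi> p = (1 / ((\<xi> p)\<^sup>2 - 1)) *\<^sub>M
    ((\<xi> p)\<^sup>2 *\<^sub>M tau k \<alpha> p + tau k \<alpha> (bar p) + (2 * \<beta> * \<xi> p) *\<^sub>M TT p)"

definition H :: "('n \<Rightarrow> complex) \<Rightarrow> 'N + 'N \<Rightarrow> ('n::finite, 'N::finite) EndVT"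
  where "H y p = wsite y (munit p p - munit (bar p) (bar p))"

definition L :: "('N + 'N \<Rightarrow> complex) \<Rightarrow> complex \<Rightarrow> complex \<Rightarrow> complex \<Rightarrow> ('n \<Rightarrow> complex) \<Rightarrow> 'N + 'N \<Rightarrow>
    ('n::{finite,linorder}, 'N::finite) EndVT"
  where "L \<xi> k \<alpha> \<beta> y p = H y p + W k \<alpha> \<beta> \<xi> p + k *\<^sub>M (\<Sum>q\<in>- {p, bar p}. R \<xi> p q)"

lemma TT_eq: "TT p = T p + T (bar p)"
  by (simp add: ee_def wsite_add)

lemma R_alt: "R \<xi> p q = (\<xi> p / (\<xi> p - \<xi> q)) *\<^sub>M X p q + (\<xi> q / (\<xi> p - \<xi> q)) *\<^sub>M X q p"
  by (simp add: R_def vec_eq_iff add_divide_distrib)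

lemma R_swap: "R \<xi> q p = - R \<xi> p q"
proof -
  have "1 / (\<xi> q - \<xi> p) = - (1 / (\<xi> p - \<xi> q))"
    by (metis minus_diff_eq minus_divide_right)
  then show ?thesis
    by (simp add: R_def vec_eq_iff add.commute)
qed

lemma classical_yang_baxter:
  assumes "indep a b" "indep a c" "indep b c" and ne: "\<xi> a \<noteq> \<xi> b" "\<xi> a \<noteq> \<xi> c" "\<xi> b \<noteq> \<xi> c"
  shows "br (R \<xi> a b) (R \<xi> b c) + br (R \<xi> a b) (R \<xi> a c) + br (R \<xi> a c) (R \<xi> b c)
    = (0 :: ('n::{finite,linorder}, 'N::finite) EndVT)"
proof -
  note ind = assms(1-3) assms(1-3)[THEN indep_sym]
  have "(br (R \<xi> a b) (R \<xi> b c) + br (R \<xi> a b) (R \<xi> a c) + br (R \<xi> a c) (R \<xi> b c)) $ f $ g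
    = (0 :: ('n, 'N) EndVT) $ f $ g" for f g
  proof -
    define B where "B = (\<lambda>p q r s. br (X p q) (X r s :: ('n, 'N) EndVT) $ f $ g)"
    have K: "B p q q r + B p q p r + B p r q r = 0" if "indep p q" "indep p r" "indep q r" for p q r
      using arg_cong[OF X_yang_baxter[OF that], of "\<lambda>A. A $ f $ g"] by (simp add: B_def)
    have swap: "B p q r s = - B r s p q" for p q r s
      by (simp add: B_def br_swap[of "X p q"])
    \<comment> \<open>The reciprocals get names, so the comparison of the two sides is polynomial
      and no denominators are cleared.\<close>
    define r1 r2 r3 where r: "r1 = 1 / (\<xi> a - \<xi> b)" "r2 = 1 / (\<xi> a - \<xi> c)" "r3 = 1 / (\<xi> b - \<xi> c)"
    have quot: "n / ((\<xi> a - \<xi> b) * (\<xi> b - \<xi> c)) = n * (r1 * r3)" "n / ((\<xi> a - \<xi> b) * (\<xi> a - \<xi> c)) = n * (r1 * r2)"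
      "n / ((\<xi> a - \<xi> c) * (\<xi> b - \<xi> c)) = n * (r2 * r3)" for n
      by (simp_all add: r)
    have "(\<xi> a * (\<xi> b * B a b b c + \<xi> c * B a b c b) + \<xi> b * (\<xi> b * B b a b c + \<xi> c * B b a c b)) / ((\<xi> a - \<xi> b) * (\<xi> b - \<xi> c))
      + (\<xi> a * (\<xi> a * B a b a c + \<xi> c * B a b c a) + \<xi> b * (\<xi> a * B b a a c + \<xi> c * B b a c a)) / ((\<xi> a - \<xi> b) * (\<xi> a - \<xi> c))
      + (\<xi> a * (\<xi> b * B a c b c + \<xi> c * B a c c b) + \<xi> c * (\<xi> b * B c a b c + \<xi> c * B c a c b)) / ((\<xi> a - \<xi> c) * (\<xi> b - \<xi> c)) = 0"
    proof (rule yang_baxter_coefficients[OF ne])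
      show "B a b b c + B a b a c + B a c b c = 0" by (rule K) (fact ind)+
      show "B a c c b - B a b a c + B a b c b = 0"
        using K[of a c b] ind by (simp add: swap[of a c a b] algebra_simps)
      show "B b a a c + B b a b c - B a c b c = 0"
        using K[of b a c] ind by (simp add: swap[of b c a c] algebra_simps)
      show "B b a c a - B c a b c - B b a b c = 0"
        using K[of b c a] ind by (simp add: swap[of b c] algebra_simps)
      show "B c a c b - B a b c a - B a b c b = 0"
        using K[of c a b] ind by (simp add: swap[of _ _ a b] algebra_simps)
      show "B b a c b + B c a c b + B b a c a = 0"
        using K[OF ind(6) ind(5) ind(4)] swap[of c b b a] swap[of c b c a] swap[of c a b a] by algebra
    qed
    then show ?thesis
      unfolding quot R_def r[symmetric] by (simp add: br_linear B_def algebra_simps)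
  qed
  then show ?thesis by (simp add: vec_eq_iff)
qed

text \<open>These are the properties of \<open>ext x\<close> at a regular point. Injectivity on the
  doubled index set encodes at once x_a distinct from x_p, x_a x_p distinct from 1 and x_a^2
  distinct from 1.\<close>

context
  fixes \<xi> :: "'N::finite + 'N \<Rightarrow> complex"
  assumes \<xi>_0: "\<And>p. \<xi> p \<noteq> 0" and \<xi>_bar: "\<And>p. \<xi> (bar p) = 1 / \<xi> p" and \<xi>_inj: "\<And>p q. p \<noteq> q \<Longrightarrow> \<xi> p \<noteq> \<xi> q"
begin

lemma \<xi>_sq: "(\<xi> p)\<^sup>2 \<noteq> 1"
  using \<xi>_inj[of "bar p" p] \<xi>_0[of p] by (auto simp: \<xi>_bar field_simps power2_eq_square)

lemma \<xi>_mult: "indep p q \<Longrightarrow> \<xi> p * \<xi> q \<noteq> 1"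
  using \<xi>_inj[of p "bar q"] \<xi>_0[of q] by (auto simp: \<xi>_bar field_simps indep_def)

lemma R_bar: "R \<xi> (bar p) (bar q) = (R \<xi> q p :: ('n::{finite,linorder}, 'N) EndVT)"
proof -
  have "\<xi> (bar p) / (\<xi> (bar p) - \<xi> (bar q)) = \<xi> q / (\<xi> q - \<xi> p)"
    "\<xi> (bar q) / (\<xi> (bar p) - \<xi> (bar q)) = \<xi> p / (\<xi> q - \<xi> p)"
    using \<xi>_0[of p] \<xi>_0[of q] by (auto simp: \<xi>_bar divide_simps)
  then show ?thesis
    by (simp add: R_alt X_bar add.commute)
qed

lemma R_bar_right:
  assumes "indep p q"
  shows "R \<xi> p (bar q) = ((1 / (\<xi> p * \<xi> q - 1)) *\<^sub>M ((\<xi> p * \<xi> q) *\<^sub>M X p (bar q) + X (bar q) p) :: ('n::{finite,linorder}, 'N) EndVT)"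
proof -
  have "\<xi> p / (\<xi> p - \<xi> (bar q)) = \<xi> p * \<xi> q / (\<xi> p * \<xi> q - 1)"
    "\<xi> (bar q) / (\<xi> p - \<xi> (bar q)) = 1 / (\<xi> p * \<xi> q - 1)"
    using \<xi>_0[of q] by (auto simp: \<xi>_bar divide_simps)
  then show ?thesis
    unfolding R_alt by (simp add: vec_eq_iff add_divide_distrib)
qed

lemma reflection_equation:
  assumes ab: "indep a b"
  shows "br (W k \<alpha> \<beta> \<xi> a) (R \<xi> a b) - br (W k \<alpha> \<beta> \<xi> a) (R \<xi> a (bar b))
    + br (W k \<alpha> \<beta> \<xi> b) (R \<xi> a b) + br (W k \<alpha> \<beta> \<xi> b) (R \<xi> a (bar b))
    = (2 * k) *\<^sub>M (br (R \<xi> a b) (R \<xi> a (bar b)) :: ('n::{finite,linorder}, 'N) EndVT)"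
    (is "?L = ?R")
proof -
  have "?L $ f $ g = ?R $ f $ g" for f g
  proof -
    define u v where "u = \<xi> a" and "v = \<xi> b"
    define A where "A = (\<lambda>r p q. br (tau k \<alpha> r) (X p q :: ('n, 'N) EndVT) $ f $ g)"
    define S where "S = (\<lambda>r p q. br (TT r) (X p q :: ('n, 'N) EndVT) $ f $ g)"
    define B where "B = (\<lambda>p q r s. k * br (X p q) (X r s :: ('n, 'N) EndVT) $ f $ g)"
    have refl: "A p p q - A p p (bar q) + A q p q + A q p (bar q) = 2 * B p q p (bar q)" if "indep p q" for p q
    proof -
      have "A p p q - A p p (bar q) + A q p q + A q p (bar q) - 2 * B p q p (bar q)
        = k * (br (X p (bar p)) (X p q) - br (X p (bar p)) (X p (bar q))
            + br (X q (bar q)) (X p q) + br (X q (bar q)) (X p (bar q))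
            - (br (X p q) (X p (bar q)) + br (X p q) (X p (bar q)) :: ('n, 'N) EndVT)) $ f $ g
        + 2 * \<alpha> * (br (T p) (X p q) - br (T p) (X p (bar q)) + br (T q) (X p q) + br (T q) (X p (bar q)) :: ('n, 'N) EndVT) $ f $ g"
        by (simp add: A_def B_def tau_def br_linear algebra_simps)
      then show ?thesis
        unfolding X_reflection[OF that] T_reflection[OF that] by simp
    qed
    have sym: "A p p q + A p (bar p) q + A (bar p) p q + A (bar p) (bar p) q = 0" if "indep p q" for p q
    proof -
      have "A p p q + A p (bar p) q + A (bar p) p q + A (bar p) (bar p) q
        = k * (br (X p (bar p)) (X p q) + br (X p (bar p)) (X (bar p) q)
            + br (X (bar p) p) (X p q) + br (X (bar p) p) (X (bar p) q) :: ('n, 'N) EndVT) $ f $ g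
        + 2 * \<alpha> * (br (T p) (X p q) + br (T p) (X (bar p) q) + br (T (bar p)) (X p q) + br (T (bar p)) (X (bar p) q) :: ('n, 'N) EndVT) $ f $ g"
        by (simp add: A_def tau_def br_linear algebra_simps)
      then show ?thesis
        unfolding X_reflection_sym[OF that] T_reflection_sym[OF that] by simp
    qed
    have symS: "S p p q + S p (bar p) q = 0" if "indep p q" for p q
      using arg_cong[OF T_reflection_sym[OF that], of "\<lambda>A. A $ f $ g"] by (simp add: S_def TT_eq br_linear algebra_simps)
    have sumS: "S a a b + S a b a + S b a b + S b b a = 0"
      using arg_cong[OF TT_X[OF ab], of "\<lambda>A. A $ f $ g"] by (simp add: S_def)
    have swp: "X (bar a) b = (X (bar b) a :: ('n, 'N) EndVT)" "X b (bar a) = (X a (bar b) :: ('n, 'N) EndVT)"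
      "X (bar a) (bar b) = (X b a :: ('n, 'N) EndVT)" "X (bar b) (bar a) = (X a b :: ('n, 'N) EndVT)"
      using X_bar[of a "bar b"] X_bar[of "bar b" a] X_bar[of b a] X_bar[of a b] by simp_all
    have sym_A: "A r (bar a) b = A r (bar b) a" "A r b (bar a) = A r a (bar b)" "A r (bar a) (bar b) = A r b a" "A r (bar b) (bar a) = A r a b"
      and sym_S: "S r (bar a) b = S r (bar b) a" "S r b (bar a) = S r a (bar b)" "S r (bar a) (bar b) = S r b a" "S r (bar b) (bar a) = S r a b" for r
      by (simp_all add: A_def S_def swp)
    have sym_B: "B b a b (bar a) = B b a a (bar b)" "B (bar a) (bar b) (bar a) b = B b a (bar b) a"
      "B (bar b) (bar a) (bar b) a = B a b (bar b) a"
      by (simp_all add: B_def swp)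
    have ba: "indep b a" using ab by (rule indep_sym)
    have ne: "u\<^sup>2 \<noteq> 1" "v\<^sup>2 \<noteq> 1" "u \<noteq> v" "u * v \<noteq> 1"
      using \<xi>_sq \<xi>_mult[OF ab] \<xi>_inj ab by (auto simp: u_def v_def indep_def)
    \<comment> \<open>The bracket is linear in \<open>W\<close>: this is the contribution of the
      \<open>tau\<close> terms, and the next identity says that the \<open>TT\<close> terms
      contribute 0.\<close>
    have 1: "(u\<^sup>2 * (u * A a a b + v * A a b a) + (u * A (bar a) a b + v * A (bar a) b a)) / ((u\<^sup>2 - 1) * (u - v))
      - (u\<^sup>2 * (u * v * A a a (bar b) + A a (bar b) a) + (u * v * A (bar a) a (bar b) + A (bar a) (bar b) a)) / ((u\<^sup>2 - 1) * (u * v - 1))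
      + (v\<^sup>2 * (u * A b a b + v * A b b a) + (u * A (bar b) a b + v * A (bar b) b a)) / ((v\<^sup>2 - 1) * (u - v))
      + (v\<^sup>2 * (u * v * A b a (bar b) + A b (bar b) a) + (u * v * A (bar b) a (bar b) + A (bar b) (bar b) a)) / ((v\<^sup>2 - 1) * (u * v - 1))
      = 2 * (u * (u * v * B a b a (bar b) + B a b (bar b) a) + v * (u * v * B b a a (bar b) + B b a (bar b) a)) / ((u - v) * (u * v - 1))"
      \<comment> \<open>The four instances of \<open>refl\<close>, at (a, b), (b, a) and their
        barred versions, supply the group \<open>E\<close> of hypotheses; the four instances of
        \<open>sym\<close> supply \<open>S\<close>.\<close>
      using refl[of a b] refl[of b a] refl[of "bar a" "bar b"] refl[of "bar b" "bar a"]
        sym[of a b] sym[of a "bar b"] sym[of b a] sym[of b "bar a"] ab ba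
      by (intro reflection_coefficients[OF ne]) (simp_all add: sym_A sym_B add_ac)
    have 2: "u * (u * S a a b + v * S a b a) / ((u\<^sup>2 - 1) * (u - v)) - u * (u * v * S a a (bar b) + S a (bar b) a) / ((u\<^sup>2 - 1) * (u * v - 1))
      + v * (u * S b a b + v * S b b a) / ((v\<^sup>2 - 1) * (u - v)) + v * (u * v * S b a (bar b) + S b (bar b) a) / ((v\<^sup>2 - 1) * (u * v - 1)) = 0"
      using symS[of a b] symS[of a "bar b"] symS[of b a] symS[of b "bar a"] ab ba
        sumS
      by (intro reflection_sym_coefficients[OF ne]) (simp_all add: sym_S add_ac)
    define w1 w2 r1 r2 where w: "w1 = 1 / (u\<^sup>2 - 1)" "w2 = 1 / (v\<^sup>2 - 1)" "r1 = 1 / (u - v)" "r2 = 1 / (u * v - 1)"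
    have quot: "n / ((u\<^sup>2 - 1) * (u - v)) = n * (w1 * r1)" "n / ((u\<^sup>2 - 1) * (u * v - 1)) = n * (w1 * r2)"
      "n / ((v\<^sup>2 - 1) * (u - v)) = n * (w2 * r1)" "n / ((v\<^sup>2 - 1) * (u * v - 1)) = n * (w2 * r2)"
      "n / ((u - v) * (u * v - 1)) = n * (r1 * r2)" for n
      by (simp_all add: w)
    have WR: "W k \<alpha> \<beta> \<xi> a = w1 *\<^sub>M (u\<^sup>2 *\<^sub>M tau k \<alpha> a + tau k \<alpha> (bar a) + (2 * \<beta> * u) *\<^sub>M TT a)"
      "W k \<alpha> \<beta> \<xi> b = w2 *\<^sub>M (v\<^sup>2 *\<^sub>M tau k \<alpha> b + tau k \<alpha> (bar b) + (2 * \<beta> * v) *\<^sub>M TT b)"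
      "R \<xi> a b = r1 *\<^sub>M (u *\<^sub>M X a b + v *\<^sub>M X b a)"
      "R \<xi> a (bar b) = r2 *\<^sub>M ((u * v) *\<^sub>M X a (bar b) + X (bar b) a)"
      by (simp_all add: w W_def R_def[of _ a b] R_bar_right[OF ab] u_def v_def)
    have "?L $ f $ g = ((u\<^sup>2 * (u * A a a b + v * A a b a) + (u * A (bar a) a b + v * A (bar a) b a)) / ((u\<^sup>2 - 1) * (u - v))
      - (u\<^sup>2 * (u * v * A a a (bar b) + A a (bar b) a) + (u * v * A (bar a) a (bar b) + A (bar a) (bar b) a)) / ((u\<^sup>2 - 1) * (u * v - 1))
      + (v\<^sup>2 * (u * A b a b + v * A b b a) + (u * A (bar b) a b + v * A (bar b) b a)) / ((v\<^sup>2 - 1) * (u - v))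
      + (v\<^sup>2 * (u * v * A b a (bar b) + A b (bar b) a) + (u * v * A (bar b) a (bar b) + A (bar b) (bar b) a)) / ((v\<^sup>2 - 1) * (u * v - 1)))
      + 2 * \<beta> * (u * (u * S a a b + v * S a b a) / ((u\<^sup>2 - 1) * (u - v)) - u * (u * v * S a a (bar b) + S a (bar b) a) / ((u\<^sup>2 - 1) * (u * v - 1))
      + v * (u * S b a b + v * S b b a) / ((v\<^sup>2 - 1) * (u - v)) + v * (u * v * S b a (bar b) + S b (bar b) a) / ((v\<^sup>2 - 1) * (u * v - 1)))"
      unfolding quot WR by (simp add: br_linear A_def S_def algebra_simps)
    moreover have "?R $ f $ g = 2 * (u * (u * v * B a b a (bar b) + B a b (bar b) a) + v * (u * v * B b a a (bar b) + B b a (bar b) a)) / ((u - v) * (u * v - 1))"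
      unfolding quot WR by (simp add: br_linear B_def algebra_simps)
    ultimately show ?thesis
      unfolding 1 2 by simp
  qed
  then show ?thesis by (simp add: vec_eq_iff)
qed


section \<open>Assembling the bracket of L_a and L_b\<close>

lemma H_R_disjoint:
  assumes "indep a p" "indep a q"
  shows "br (H y a) (R \<xi> p q :: ('n::{finite,linorder}, 'N) EndVT) = 0"
  using assms by (simp add: H_def R_def wsite_diff br_linear wsite_X_disjoint)

lemma W_R_disjoint:
  assumes "indep a p" "indep a q"
  shows "br (W k \<alpha> \<beta> \<xi> a) (R \<xi> p q :: ('n::{finite,linorder}, 'N) EndVT) = 0"
  using assms by (simp add: W_def tau_def TT_eq R_def br_linear wsite_X_disjoint X_disjoint)

lemma H_H_disjoint:
  assumes "indep a b"
  shows "br (H y a) (H z b :: ('n::{finite,linorder}, 'N) EndVT) = 0"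
  using assms indep_neq[OF assms]
  by (simp add: H_def wsite_diff br_linear br_wsite_wsite munit_mult)

lemma H_W_disjoint:
  assumes "indep a b"
  shows "br (H y a) (W k \<alpha> \<beta> \<xi> b :: ('n::{finite,linorder}, 'N) EndVT) = 0"
  using assms indep_neq[OF assms]
  by (simp add: H_def W_def tau_def TT_eq wsite_diff br_linear br_wsite_wsite munit_mult wsite_X_disjoint)

lemma W_W_disjoint:
  assumes "indep a b"
  shows "br (W k \<alpha> \<beta> \<xi> a) (W k \<alpha> \<beta> \<xi> b :: ('n::{finite,linorder}, 'N) EndVT) = 0"
  using assms indep_neq[OF assms] assms[THEN indep_sym]
  by (simp add: W_def tau_def TT_eq br_linear br_wsite_wsite munit_mult wsite_X_disjoint X_disjoint
      br_swap[of "X _ _" "wsite _ _"])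

lemma R_R_disjoint:
  assumes "indep a c" "indep a d" "indep b c" "indep b d"
  shows "br (R \<xi> a b) (R \<xi> c d :: ('n::{finite,linorder}, 'N) EndVT) = 0"
  using assms by (simp add: R_def br_linear X_disjoint)

text \<open>The total \<open>H y p + H y q\<close> is a weight operator preserved by both
  \<open>X p q\<close> and \<open>X q p\<close>. Applied with \<open>bar q\<close>, where
  \<open>H\<close> changes sign, it gives the relation for R_p(bar q).\<close>

lemma H_weight:
  assumes "indep p q"
  shows "br (H y p) (R \<xi> p q) + br (H y q) (R \<xi> p q :: ('n::{finite,linorder}, 'N) EndVT) = 0"
proof -
  have sum: "H y p + H y q = wsite y (munit p p + munit q q - (munit (bar p) (bar p) + munit (bar q) (bar q)))"
    "H y p + H y q = wsite y (munit q q + munit p p - (munit (bar q) (bar q) + munit (bar p) (bar p)))"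
    by (simp_all add: H_def wsite_add wsite_diff)
  have "br (H y p + H y q) (X p q :: ('n, 'N) EndVT) = 0"
    unfolding sum(1) by (rule wsite_X_weight[OF assms])
  moreover have "br (H y p + H y q) (X q p :: ('n, 'N) EndVT) = 0"
    unfolding sum(2) by (rule wsite_X_weight[OF assms[THEN indep_sym]])
  ultimately have "br (H y p + H y q) (R \<xi> p q :: ('n, 'N) EndVT) = 0"
    by (simp add: R_def br_add_right br_scale_right)
  then show ?thesis by (simp add: br_add_left)
qed

lemma H_bar: "H y (bar p) = - H y p"
  by (simp add: H_def flip: wsite_minus)

lemma L_commute:
  assumes ab: "indep a b"
  shows "br (L \<xi> k \<alpha> \<beta> y a) (L \<xi> k \<alpha> \<beta> y b :: ('n::{finite,linorder}, 'N) EndVT) = 0"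
proof -
  note ba = indep_sym[OF ab]
  define J where "J = - {a, bar a, b, bar b}"
  define P Q where "P = (R \<xi> a b :: ('n, 'N) EndVT)" and "Q = (R \<xi> a (bar b) :: ('n, 'N) EndVT)"
  define A B where "A = (\<lambda>p. R \<xi> a p :: ('n, 'N) EndVT)" and "B = (\<lambda>p. R \<xi> b p :: ('n, 'N) EndVT)"
  define Ha Hb where "Ha = (H y a :: ('n, 'N) EndVT)" and "Hb = (H y b :: ('n, 'N) EndVT)"
  define Wa Wb where "Wa = (W k \<alpha> \<beta> \<xi> a :: ('n, 'N) EndVT)" and "Wb = (W k \<alpha> \<beta> \<xi> b :: ('n, 'N) EndVT)"
  have J: "indep a p" "indep b p" "indep p a" "indep p b" if "p \<in> J" for p
    using that by (auto simp: J_def indep_def)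
  have La: "(\<Sum>q\<in>- {a, bar a}. R \<xi> a q) = P + Q + sum A J"
  proof -
    have "- {a, bar a} = insert b (insert (bar b) J)" "b \<notin> insert (bar b) J" "bar b \<notin> J"
      using indep_neq[OF ab] by (auto simp: J_def)
    then show ?thesis by (simp add: P_def Q_def A_def add.assoc)
  qed
  \<comment> \<open>The signs differ between the two operators: R is antisymmetric, whereas R_b(bar
    a) = R_a(bar b) by \<open>R_bar\<close>.\<close>
  have Lb: "(\<Sum>q\<in>- {b, bar b}. R \<xi> b q) = - P + Q + sum B J"
  proof -
    have "- {b, bar b} = insert a (insert (bar a) J)" "a \<notin> insert (bar a) J" "bar a \<notin> J"
      using indep_neq[OF ab] by (auto simp: J_def)
    moreover have "R \<xi> b a = - P" "R \<xi> b (bar a) = Q"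
      using R_swap[of \<xi> b a] R_bar[of "bar b" a] by (simp_all add: P_def Q_def)
    ultimately show ?thesis by (simp add: B_def add.assoc)
  qed
  \<comment> \<open>the summand for \<open>p\<close> is the Yang-Baxter equation for \<open>(a, b, p)\<close> minus the one for \<open>(a, bar b, p)\<close>,
     once \<open>br Q (B p)\<close> is reindexed by \<open>bar\<close>\<close>
  have "br P (sum B J) + br Q (sum B J) + br P (sum A J) - br Q (sum A J) + br (sum A J) (sum B J) = 0"
  proof -
    have QB: "br Q (sum B J) = (\<Sum>p\<in>J. br Q (B (bar p)))"
      unfolding br_sum_right
      by (rule sum.reindex_bij_witness[of _ bar bar]) (auto simp: J_def bar_eq_swap)
    \<comment> \<open>Only \<open>q\<close> in the class {p, bar p} can fail to commute, since
      otherwise the index pairs (a, p) and (b, q) are independent.\<close>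
    have "br (A p) (sum B J) = br (A p) (B p) + br (A p) (B (bar p))" if "p \<in> J" for p
    proof -
      have "(\<Sum>q\<in>J. br (A p) (B q)) = (\<Sum>q\<in>{p, bar p}. br (A p) (B q))"
      proof (rule sum.mono_neutral_right)
        show "{p, bar p} \<subseteq> J" using that by (auto simp: J_def bar_eq_swap)
        show "\<forall>q\<in>J - {p, bar p}. br (A p) (B q) = 0"
          using J that ab by (auto simp: A_def B_def indep_def bar_eq_swap intro!: R_R_disjoint)
      qed simp
      then show ?thesis by (simp add: br_sum_right)
    qed
    then have AB: "br (sum A J) (sum B J) = (\<Sum>p\<in>J. br (A p) (B p) + br (A p) (B (bar p)))"
      by (simp add: br_sum_left)
    have 1: "br P (B p) + br P (A p) + br (A p) (B p) = 0" if "p \<in> J" for p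
      unfolding P_def A_def B_def using J[OF that] ab indep_neq
      by (intro classical_yang_baxter \<xi>_inj) auto
    have 2: "br Q (A p) - br Q (B (bar p)) - br (A p) (B (bar p)) = 0" if "p \<in> J" for p
    proof -
      have "R \<xi> (bar b) p = - B (bar p)"
        unfolding B_def by (metis R_bar R_swap bar_bar)
      moreover have "br Q (R \<xi> (bar b) p) + br Q (R \<xi> a p) + br (R \<xi> a p) (R \<xi> (bar b) p) = 0"
        unfolding Q_def using J[OF that] ab indep_neq[of a b] indep_neq[of a p] indep_neq[of b p]
        by (intro classical_yang_baxter \<xi>_inj) auto
      ultimately show ?thesis by (simp add: A_def br_minus_right)
    qed
    have "br P (sum B J) + br Q (sum B J) + br P (sum A J) - br Q (sum A J) + br (sum A J) (sum B J)
      = (\<Sum>p\<in>J. (br P (B p) + br P (A p) + br (A p) (B p))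
          - (br Q (A p) - br Q (B (bar p)) - br (A p) (B (bar p))))"
      unfolding QB AB by (simp add: br_sum_right sum.distrib sum_subtractf algebra_simps)
    also have "\<dots> = 0" using 1 2 by (intro sum.neutral) auto
    finally show ?thesis .
  qed
  then have sum0: "br P (sum B J) = - br Q (sum B J) - br P (sum A J) + br Q (sum A J) - br (sum A J) (sum B J)"
    by (simp add: algebra_simps eq_neg_iff_add_eq_0)
  \<comment> \<open>Like \<open>sum0\<close>, each relation is solved for a single bracket, so that
    it can serve as a rewrite rule in the final computation.\<close>
  have refl: "br Wb Q = (2 * k) *\<^sub>M br P Q - br Wa P + br Wa Q - br Wb P"
    using reflection_equation[OF ab, of k \<alpha> \<beta>] by (simp add: P_def Q_def Wa_def Wb_def algebra_simps)
  have HP: "br Hb P = - br Ha P" and HQ: "br Hb Q = br Ha Q"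
    using H_weight[OF ab, of y] H_weight[of a "bar b" y] ab
    by (simp_all add: P_def Q_def Ha_def Hb_def H_bar br_minus_left eq_neg_iff_add_eq_0 add.commute)
  have zero: "br Ha (sum B J) = 0" "br Wa (sum B J) = 0" "br Hb (sum A J) = 0" "br Wb (sum A J) = 0"
    using J ab ba by (auto simp: br_sum_right Ha_def Hb_def Wa_def Wb_def A_def B_def H_R_disjoint W_R_disjoint intro!: sum.neutral)
  have zero': "br Ha Hb = 0" "br Ha Wb = 0" "br Hb Wa = 0" "br Wa Wb = 0"
    using ab ba by (simp_all add: Ha_def Hb_def Wa_def Wb_def H_H_disjoint H_W_disjoint W_W_disjoint)
  have "br (L \<xi> k \<alpha> \<beta> y a) (L \<xi> k \<alpha> \<beta> y b) =
    br (Ha + Wa + k *\<^sub>M (P + Q + sum A J)) (Hb + Wb + k *\<^sub>M (- P + Q + sum B J))"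
    by (simp add: L_def La Lb Ha_def Hb_def Wa_def Wb_def)
  also have "\<dots> = 0"
  proof -
    \<comment> \<open>On entries the scalings are ordinary products; the instances of
      \<open>br_swap\<close> bring all brackets into the orientation of the relations above.\<close>
    have "br (Ha + Wa + k *\<^sub>M (P + Q + sum A J)) (Hb + Wb + k *\<^sub>M (- P + Q + sum B J)) $ f $ g = 0" for f g
      by (simp add: br_linear zero zero' HP HQ sum0 refl br_swap[of Wa Hb] br_swap[of P Hb] br_swap[of P Wb]
          br_swap[of Q Hb] br_swap[of Q Wb] br_swap[of "sum A J" Hb] br_swap[of "sum A J" Wb]
          br_swap[of Q P] br_swap[of "sum A J" P] br_swap[of "sum A J" Q] algebra_simps)
    then show ?thesis by (simp add: vec_eq_iff)
  qed
  finally show ?thesis .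
qed

end

section \<open>Commutativity of the differential operators\<close>

lemma XX_eq: "XX a b = X (Inl a) (Inl b)"
  by (simp add: XX_def X_def xx_def EE_def ee_def)

lemma YY_eq: "YY a b = X (Inl a) (Inr b)"
  by (simp add: YY_def X_def xx_def EEbar_def ee_def add.commute)

lemma ZZ_eq: "ZZ a b = X (Inr b) (Inl a)"
  by (simp add: ZZ_def X_def xx_def EEbar_def ee_def add.commute)

lemma YY_commute: "YY a b = YY b a"
  unfolding YY_eq by (subst X_bar[symmetric]) simp

lemma ZZ_commute: "ZZ a b = ZZ b a"
  unfolding ZZ_eq by (subst X_bar[symmetric]) simp

section \<open>Identification of \<open>LL\<close> with the order-free operator
  \<open>L\<close>\<close>

definition ext :: "complex ^ 'N \<Rightarrow> 'N + 'N \<Rightarrow> complex"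
  where "ext x p = (case p of Inl a \<Rightarrow> x $ a | Inr a \<Rightarrow> 1 / x $ a)"

lemma ext_simps [simp]: "ext x (Inl a) = x $ a" "ext x (Inr a) = 1 / x $ a"
  by (simp_all add: ext_def)

lemma regular_locusD:
  assumes "x \<in> regular_locus"
  shows "x $ a \<noteq> 0" "a \<noteq> p \<Longrightarrow> x $ a \<noteq> x $ p" "x $ a * x $ p \<noteq> 1"
  using assms by (auto simp: regular_locus_def)

lemma ext_nonzero: "x \<in> regular_locus \<Longrightarrow> ext x p \<noteq> 0"
  by (cases p) (auto dest: regular_locusD)

lemma ext_bar: "ext x (bar p) = 1 / ext x p"
  by (cases p) auto

lemma ext_inj: "x \<in> regular_locus \<Longrightarrow> p \<noteq> q \<Longrightarrow> ext x p \<noteq> ext x q"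
  using regular_locusD[of x] by (cases p; cases q) (auto simp: divide_simps mult.commute)

lemma site_diff: "site (u - v) j = site u j - site v j"
  using site_add[of u "- v" j] by (simp add: site_minus)

text \<open>The constant terms of \<open>AA\<close> remove the order: -X_pa + x_a (X_ap + X_pa) /
  (x_a - x_p) for p < a and X_ap + x_p (X_ap + X_pa) / (x_a - x_p) for p > a are both (x_a X_ap +
  x_p X_pa) / (x_a - x_p).\<close>

lemma LL_eq_L:
  fixes x :: "complex ^ 'N::{finite,linorder}" and y :: "complex ^ 'n::{finite,linorder}"
  assumes x: "x \<in> regular_locus"
  shows "LL k \<alpha> \<beta> y x a = L (ext x) k \<alpha> \<beta> (\<lambda>j. y $ j) (Inl a)"
proof -
  have "LL k \<alpha> \<beta> y x a $ f $ g = L (ext x) k \<alpha> \<beta> (\<lambda>j. y $ j) (Inl a) $ f $ g" for f g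
  proof -
    define u where "u = x $ a"
    define h t t' where "h = (H (\<lambda>j. y $ j) (Inl a) :: ('n, 'N) EndVT) $ f $ g"
      and "t = (T (Inl a) :: ('n, 'N) EndVT) $ f $ g" and "t' = (T (Inr a) :: ('n, 'N) EndVT) $ f $ g"
    define X1 X2 Y Z where "X1 = (\<lambda>p. (XX a p :: ('n, 'N) EndVT) $ f $ g)" and "X2 = (\<lambda>p. (XX p a :: ('n, 'N) EndVT) $ f $ g)"
      and "Y = (\<lambda>p. (YY a p :: ('n, 'N) EndVT) $ f $ g)" and "Z = (\<lambda>p. (ZZ a p :: ('n, 'N) EndVT) $ f $ g)"
    have u: "u \<noteq> 0" "u\<^sup>2 \<noteq> 1" and ne: "\<And>p. p \<noteq> a \<Longrightarrow> u \<noteq> x $ p" "\<And>p. u * x $ p \<noteq> 1" "\<And>p. x $ p \<noteq> 0"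
      using regular_locusD[OF x] by (auto simp: u_def power2_eq_square)
    have hsum: "(\<Sum>j\<in>UNIV. y $ j *\<^sub>M (site (munit (Inl a) (Inl a)) j - site (munit (Inr a) (Inr a)) j) :: ('n, 'N) EndVT) $ f $ g = h"
      by (simp add: h_def H_def wsite_def site_diff)
    have tsum: "(\<Sum>j\<in>UNIV. site (munit (Inl a) (Inr a)) j :: ('n, 'N) EndVT) $ f $ g = t"
      by (simp add: t_def wsite_def)
    have ttsum: "(\<Sum>j\<in>UNIV. site (EEbar a a) j :: ('n, 'N) EndVT) $ f $ g = t + t'"
      by (simp add: t_def t'_def wsite_def EEbar_def site_add sum.distrib)
    have split: "(\<Sum>p\<in>UNIV - {a}. F p) = (\<Sum>p\<in>{..<a}. F p) + (\<Sum>p\<in>{a<..}. F p)" for F :: "'N \<Rightarrow> complex"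
    proof -
      have "UNIV - {a} = {..<a} \<union> {a<..}" by auto
      moreover have "{..<a} \<inter> {a<..} = {}" by auto
      ultimately show ?thesis by (simp add: sum.union_disjoint)
    qed
    have XL: "- (\<Sum>p\<in>{..<a}. X2 p) + (\<Sum>p\<in>{..<a}. u / (u - x $ p) * (X1 p + X2 p))
        = (\<Sum>p\<in>{..<a}. (u * X1 p + x $ p * X2 p) / (u - x $ p))"
      unfolding sum_negf[symmetric] sum.distrib[symmetric]
    proof (rule sum.cong)
      fix p assume "p \<in> {..<a}"
      then have "u - x $ p \<noteq> 0" using ne(1)[of p] by auto
      then show "- X2 p + u / (u - x $ p) * (X1 p + X2 p) = (u * X1 p + x $ p * X2 p) / (u - x $ p)"
        by (simp add: field_simps)
    qed simp
    have XR: "(\<Sum>p\<in>{a<..}. X1 p) + (\<Sum>p\<in>{a<..}. x $ p / (u - x $ p) * (X1 p + X2 p))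
        = (\<Sum>p\<in>{a<..}. (u * X1 p + x $ p * X2 p) / (u - x $ p))"
      unfolding sum.distrib[symmetric]
    proof (rule sum.cong)
      fix p assume "p \<in> {a<..}"
      then have "u - x $ p \<noteq> 0" using ne(1)[of p] by auto
      then show "X1 p + x $ p / (u - x $ p) * (X1 p + X2 p) = (u * X1 p + x $ p * X2 p) / (u - x $ p)"
        by (simp add: field_simps)
    qed simp
    \<comment> \<open>The term p = a goes into \<open>W\<close>; each other term is R_a(bar p) after
      clearing 1 / x_p.\<close>
    have YZ: "(\<Sum>p\<in>UNIV. Y p) + (\<Sum>p\<in>UNIV. 1 / (u * x $ p - 1) * (Y p + Z p))
        = (u\<^sup>2 * Y a + Z a) / (u\<^sup>2 - 1) + (\<Sum>p\<in>UNIV - {a}. (u * x $ p * Y p + Z p) / (u * x $ p - 1))"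
    proof -
      have "(\<Sum>p\<in>UNIV. Y p) + (\<Sum>p\<in>UNIV. 1 / (u * x $ p - 1) * (Y p + Z p))
        = (\<Sum>p\<in>UNIV. (u * x $ p * Y p + Z p) / (u * x $ p - 1))"
        unfolding sum.distrib[symmetric]
      proof (rule sum.cong)
        fix p
        have "u * x $ p - 1 \<noteq> 0" using ne(2)[of p] by auto
        then show "Y p + 1 / (u * x $ p - 1) * (Y p + Z p) = (u * x $ p * Y p + Z p) / (u * x $ p - 1)"
          by (simp add: field_simps)
      qed simp
      also have "\<dots> = (u * x $ a * Y a + Z a) / (u * x $ a - 1) + (\<Sum>p\<in>UNIV - {a}. (u * x $ p * Y p + Z p) / (u * x $ p - 1))"
        by (rule sum.remove) auto
      finally show ?thesis
        by (simp only: power2_eq_square u_def)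
    qed
    have site_part: "2 * \<alpha> * t + 2 * ((\<alpha> + \<beta> * u) / (u\<^sup>2 - 1)) * (t + t')
        = (u\<^sup>2 * (2 * \<alpha> * t) + 2 * \<alpha> * t' + 2 * \<beta> * u * (t + t')) / (u\<^sup>2 - 1)"
    proof -
      have "u\<^sup>2 - 1 \<noteq> 0" using u by auto
      then show ?thesis by (simp add: field_simps)
    qed
    have "LL k \<alpha> \<beta> y x a $ f $ g = h + (2 * \<alpha> * t + 2 * ((\<alpha> + \<beta> * u) / (u\<^sup>2 - 1)) * (t + t'))
      + k * ((- (\<Sum>p\<in>{..<a}. X2 p) + (\<Sum>p\<in>{..<a}. u / (u - x $ p) * (X1 p + X2 p)))
        + ((\<Sum>p\<in>{a<..}. X1 p) + (\<Sum>p\<in>{a<..}. x $ p / (u - x $ p) * (X1 p + X2 p)))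
        + ((\<Sum>p\<in>UNIV. Y p) + (\<Sum>p\<in>UNIV. 1 / (u * x $ p - 1) * (Y p + Z p))))"
      unfolding LL_def AA_def BB_def vector_add_component mscale_nth hsum tsum ttsum
      by (simp add: X1_def X2_def Y_def Z_def u_def algebra_simps)
    also have "\<dots> = h + (u\<^sup>2 * (2 * \<alpha> * t) + 2 * \<alpha> * t' + 2 * \<beta> * u * (t + t')) / (u\<^sup>2 - 1)
      + k * ((u\<^sup>2 * Y a + Z a) / (u\<^sup>2 - 1) + (\<Sum>p\<in>UNIV - {a}. (u * X1 p + x $ p * X2 p) / (u - x $ p))
        + (\<Sum>p\<in>UNIV - {a}. (u * x $ p * Y p + Z p) / (u * x $ p - 1)))"
      unfolding site_part XL XR YZ split[of "\<lambda>p. (u * X1 p + x $ p * X2 p) / (u - x $ p)"]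
      by (simp add: algebra_simps)
    also have "\<dots> = L (ext x) k \<alpha> \<beta> (\<lambda>j. y $ j) (Inl a) $ f $ g"
    proof -
      have set: "- {Inl a, Inr a} = Inl ` (UNIV - {a}) \<union> Inr ` (UNIV - {a})"
      proof (rule set_eqI)
        fix q show "q \<in> - {Inl a, Inr a} \<longleftrightarrow> q \<in> Inl ` (UNIV - {a}) \<union> Inr ` (UNIV - {a})"
          by (cases q) auto
      qed
      have R1: "(R (ext x) (Inl a) (Inl p) :: ('n, 'N) EndVT) $ f $ g = (u * X1 p + x $ p * X2 p) / (u - x $ p)" for p
        by (simp add: R_def u_def X1_def X2_def XX_eq)
      have R2: "(R (ext x) (Inl a) (Inr p) :: ('n, 'N) EndVT) $ f $ g = (u * x $ p * Y p + Z p) / (u * x $ p - 1)" for p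
      proof -
        have "u * x $ p - 1 \<noteq> 0" using ne(2)[of p] by auto
        then show ?thesis
          using ne(3)[of p] by (simp add: R_def Y_def Z_def YY_eq ZZ_eq field_simps flip: u_def)
      qed
      have "(\<Sum>q\<in>- {Inl a, Inr a}. R (ext x) (Inl a) q :: ('n, 'N) EndVT) $ f $ g
        = (\<Sum>p\<in>UNIV - {a}. (u * X1 p + x $ p * X2 p) / (u - x $ p))
        + (\<Sum>p\<in>UNIV - {a}. (u * x $ p * Y p + Z p) / (u * x $ p - 1))"
        unfolding set by (subst sum.union_disjoint) (auto simp: sum.reindex R1 R2)
      moreover have "(W k \<alpha> \<beta> (ext x) (Inl a) :: ('n, 'N) EndVT) $ f $ g
        = (u\<^sup>2 * (2 * \<alpha> * t) + 2 * \<alpha> * t' + 2 * \<beta> * u * (t + t')) / (u\<^sup>2 - 1) + k * ((u\<^sup>2 * Y a + Z a) / (u\<^sup>2 - 1))"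
        by (simp add: W_def tau_def ee_def wsite_add t_def t'_def Y_def Z_def YY_eq ZZ_eq add_divide_distrib algebra_simps flip: u_def)
      ultimately show ?thesis
        by (simp add: L_def h_def algebra_simps)
    qed
    finally show ?thesis .
  qed
  then show ?thesis by (simp add: vec_eq_iff)
qed

section \<open>The derivative of L_b in the coordinate x_a\<close>

lemma DERIV_sum_single:
  fixes h :: "'i \<Rightarrow> complex \<Rightarrow> complex"
  assumes "finite S" "\<And>p. p \<in> S \<Longrightarrow> p \<noteq> a \<Longrightarrow> (h p has_field_derivative 0) (at z)"
    and "a \<in> S \<Longrightarrow> (h a has_field_derivative D) (at z)"
  shows "((\<lambda>z. \<Sum>p\<in>S. h p z * c p) has_field_derivative (if a \<in> S then D * c a else 0)) (at z)"
proof -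
  have "((\<lambda>z. \<Sum>p\<in>S. h p z * c p) has_field_derivative (\<Sum>p\<in>S. if p = a then D * c a else 0)) (at z)"
  proof (rule DERIV_sum)
    fix p assume "p \<in> S"
    then show "((\<lambda>z. h p z * c p) has_field_derivative (if p = a then D * c a else 0)) (at z)"
      using DERIV_cmult_right[OF assms(2), of p "c p"] DERIV_cmult_right[OF assms(3), of "c a"] by auto
  qed
  then show ?thesis using assms(1) by simp
qed

text \<open>Only the summands with p = a vary. Since z / (x_b - z) and x_b / (x_b - z) differ by a
  constant, the cases a < b and a > b give the same derivative. Multiplied by x_a the result is
  symmetric in a and b, because \<open>YY\<close> and \<open>ZZ\<close> are symmetric.\<close>

lemma LL_deriv:
  fixes k :: complex and x :: "complex ^ 'N::{finite,linorder}" and y :: "complex ^ 'n::{finite,linorder}"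
  assumes x: "x \<in> regular_locus" and ab: "a \<noteq> b"
  defines "Lb \<equiv> k *\<^sub>M ((x $ b / (x $ b - x $ a)\<^sup>2) *\<^sub>M (XX b a + XX a b)
      - (x $ b / (x $ b * x $ a - 1)\<^sup>2) *\<^sub>M (YY b a + ZZ b a)) :: ('n, 'N) EndVT"
  shows "((\<lambda>z. LL k \<alpha> \<beta> y (upd x a z) b $ f $ g) has_field_derivative Lb $ f $ g) (at (x $ a))"
proof -
  have ne: "x $ b - x $ a \<noteq> 0" "x $ b * x $ a - 1 \<noteq> 0"
    using regular_locusD[OF x] ab by auto
  let ?C = "\<lambda>p. (XX b p + XX p b :: ('n, 'N) EndVT) $ f $ g"
  let ?E = "\<lambda>p. (YY b p + ZZ b p :: ('n, 'N) EndVT) $ f $ g"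
  let ?d = "x $ b / (x $ b - x $ a)\<^sup>2"
  have 1: "((\<lambda>z. \<Sum>p\<in>{..<b}. x $ b / (x $ b - upd x a z $ p) * ?C p) has_field_derivative (if a \<in> {..<b} then ?d * ?C a else 0)) (at (x $ a))"
    using ne by (intro DERIV_sum_single) (auto intro!: derivative_eq_intros simp: field_simps power2_eq_square)
  have 2: "((\<lambda>z. \<Sum>p\<in>{b<..}. upd x a z $ p / (x $ b - upd x a z $ p) * ?C p) has_field_derivative (if a \<in> {b<..} then ?d * ?C a else 0)) (at (x $ a))"
    using ne by (intro DERIV_sum_single) (auto intro!: derivative_eq_intros simp: field_simps power2_eq_square)
  have 3: "((\<lambda>z. \<Sum>p\<in>UNIV. 1 / (x $ b * upd x a z $ p - 1) * ?E p) has_field_derivative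
      (if a \<in> UNIV then - (x $ b / (x $ b * x $ a - 1)\<^sup>2) * ?E a else 0)) (at (x $ a))"
  proof (rule DERIV_sum_single)
    fix p assume "p \<noteq> a"
    then show "((\<lambda>z. 1 / (x $ b * upd x a z $ p - 1)) has_field_derivative 0) (at (x $ a))" by simp
  next
    show "((\<lambda>z. 1 / (x $ b * upd x a z $ a - 1)) has_field_derivative - (x $ b / (x $ b * x $ a - 1)\<^sup>2)) (at (x $ a))"
      using ne by (auto intro!: derivative_eq_intros simp: power2_eq_square)
  qed simp
  have eq: "(\<lambda>z. LL k \<alpha> \<beta> y (upd x a z) b $ f $ g) = (\<lambda>z. (AA k \<alpha> y b :: ('n, 'N) EndVT) $ f $ g
      + (2 * ((\<alpha> + \<beta> * x $ b) / ((x $ b)\<^sup>2 - 1))) * (\<Sum>j\<in>UNIV. site (EEbar b b) j :: ('n, 'N) EndVT) $ f $ g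
      + k * ((\<Sum>p\<in>{..<b}. x $ b / (x $ b - upd x a z $ p) * ?C p)
        + (\<Sum>p\<in>{b<..}. upd x a z $ p / (x $ b - upd x a z $ p) * ?C p)
        + (\<Sum>p\<in>UNIV. 1 / (x $ b * upd x a z $ p - 1) * ?E p)))"
    using ab by (simp add: LL_def BB_def del: upd_nth) (simp add: add.assoc)
  have "((\<lambda>z. LL k \<alpha> \<beta> y (upd x a z) b $ f $ g) has_field_derivative
      0 + k * ((if a \<in> {..<b} then ?d * ?C a else 0) + (if a \<in> {b<..} then ?d * ?C a else 0)
        + (if a \<in> UNIV then - (x $ b / (x $ b * x $ a - 1)\<^sup>2) * ?E a else 0))) (at (x $ a))"
    unfolding eq by (intro DERIV_add[OF DERIV_const] DERIV_cmult DERIV_add 1 2 3)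
  moreover have "0 + k * ((if a \<in> {..<b} then ?d * ?C a else 0) + (if a \<in> {b<..} then ?d * ?C a else 0)
        + (if a \<in> UNIV then - (x $ b / (x $ b * x $ a - 1)\<^sup>2) * ?E a else 0)) = Lb $ f $ g"
    using ab by (cases a b rule: linorder_cases) (auto simp: Lb_def)
  ultimately show ?thesis by simp
qed

theorem proposition3p2:
  fixes c k \<alpha> \<beta> :: complex
    and y :: "complex ^ 'n::{finite,linorder}"
    and a b :: "'N::{finite,linorder}"
    and U :: "(complex ^ 'N::{finite,linorder}) set"
    and F :: "complex ^ 'N::{finite,linorder} \<Rightarrow> ('n, 'N) VT"
    and x :: "complex ^ 'N::{finite,linorder}"
  assumes "c \<noteq> 0" "k \<noteq> 0" "\<alpha> \<noteq> 0" "\<beta> \<noteq> 0"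
    and "open U" "U \<subseteq> regular_locus"
    and "holomorphic_vec F U"
    and "x \<in> U"
  shows "commutator (DD c k \<alpha> \<beta> y a) (DD c k \<alpha> \<beta> y b) F x = 0"
proof (cases "a = b")
  case True
  then show ?thesis by (simp add: commutator_def)
next
  case False
  have x: "x \<in> regular_locus" using assms by auto
  have "br (LL k \<alpha> \<beta> y x a) (LL k \<alpha> \<beta> y x b) = 0"
    unfolding LL_eq_L[OF x] using False
    by (intro L_commute ext_nonzero ext_bar ext_inj x) (simp_all add: indep_def)
  then have comm: "LL k \<alpha> \<beta> y x a ** LL k \<alpha> \<beta> y x b = LL k \<alpha> \<beta> y x b ** LL k \<alpha> \<beta> y x a"
    by (simp add: br_def)
  have "DD c k \<alpha> \<beta> y a (DD c k \<alpha> \<beta> y b F) x = DD c k \<alpha> \<beta> y b (DD c k \<alpha> \<beta> y a F) x"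
    unfolding DD_def
    by (rule connection_commute[OF \<open>open U\<close> \<open>x \<in> U\<close> \<open>holomorphic_vec F U\<close> False LL_deriv[OF x False] LL_deriv[OF x False[symmetric]] _ comm])
      (simp add: YY_commute[of b a] ZZ_commute[of b a] power2_commute[of "x $ b" "x $ a"] algebra_simps)
  then show ?thesis by (simp add: commutator_def)
qed

end
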